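(* Let $\mathcal D$ be a universal set of numbers and let $\mathrm M=(M,d)\in\mathfrak U_{\mathcal D}$. Then $\mathrm M$ is indivisible: for every colouring $\chi:M\to\{0,1\}$ there exist $i\in\{0,1\}$ and a copy $\mathrm N=(N,d)$ of $\mathrm M$ in $\mathrm M$ such that $\chi(x)=i$ for all $x\in N$.
   Context: $\mathcal D$ denotes a finite subset of $\mathbb R_{\ge0}$ with $0\in\mathcal D$. $\mathfrak M_{\mathcal D}$ is the class of metric spaces all of whose distances lie in $\mathcal D$. A metric space is homogeneous if every isometry between finite subspaces extends to an isometry of the whole space onto itself. A countable homogeneous metric space whose set of distances is exactly $\mathcal D$ and into which every finite metric space of $\mathfrak M_{\mathcal D}$ embeds isometrically is a (countable) Urysohn space for $\mathcal D$; $\mathfrak U_{\mathcal D}$ denotes the class of these spaces (they are all isometric to one another), and $\mathbf U_{\mathcal D}$ denotes one of them. $\mathcal D$ is universal if $\mathfrak U_{\mathcal D}\ne\emptyset$. A copy of $\mathrm M$ in $\mathrm M$ is the image of an isometric embedding of $\mathrm M$ into itself, with the induced metric. *)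

theory Defs
  imports "HOL-Analysis.Analysis"
begin

definition metric_on :: "'a set \<Rightarrow> ('a \<Rightarrow> 'a \<Rightarrow> real) \<Rightarrow> bool" where
  "metric_on M d \<longleftrightarrow>
     (\<forall>x\<in>M. \<forall>y\<in>M. 0 \<le> d x y \<and> (d x y = 0 \<longleftrightarrow> x = y) \<and> d x y = d y x) \<and>
     (\<forall>x\<in>M. \<forall>y\<in>M. \<forall>z\<in>M. d x z \<le> d x y + d y z)"

definition dist_set :: "'a set \<Rightarrow> ('a \<Rightarrow> 'a \<Rightarrow> real) \<Rightarrow> real set" where
  "dist_set M d = {d x y | x y. x \<in> M \<and> y \<in> M}"

definition isometric_embedding ::
  "'a set \<Rightarrow> ('a \<Rightarrow> 'a \<Rightarrow> real) \<Rightarrow> 'b set \<Rightarrow> ('b \<Rightarrow> 'b \<Rightarrow> real) \<Rightarrow> ('a \<Rightarrow> 'b) \<Rightarrow> bool" where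
  "isometric_embedding A dA B dB f \<longleftrightarrow>
     f ` A \<subseteq> B \<and> (\<forall>x\<in>A. \<forall>y\<in>A. dB (f x) (f y) = dA x y)"

definition isometry_onto ::
  "'a set \<Rightarrow> ('a \<Rightarrow> 'a \<Rightarrow> real) \<Rightarrow> 'b set \<Rightarrow> ('b \<Rightarrow> 'b \<Rightarrow> real) \<Rightarrow> ('a \<Rightarrow> 'b) \<Rightarrow> bool" where
  "isometry_onto A dA B dB f \<longleftrightarrow>
     bij_betw f A B \<and> (\<forall>x\<in>A. \<forall>y\<in>A. dB (f x) (f y) = dA x y)"

definition homogeneous :: "'a set \<Rightarrow> ('a \<Rightarrow> 'a \<Rightarrow> real) \<Rightarrow> bool" where
  "homogeneous M d \<longleftrightarrow>
     (\<forall>F G g. F \<subseteq> M \<and> G \<subseteq> M \<and> finite F \<and> finite G \<and> isometry_onto F d G d g \<longrightarrow>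
        (\<exists>h. isometry_onto M d M d h \<and> (\<forall>x\<in>F. h x = g x)))"

text \<open>(M,d) is a countable Urysohn space for the distance set D, i.e. (M,d) is in U_D.
  Finite metric spaces are represented (up to isometry) on finite subsets of nat.\<close>
definition urysohn_space :: "real set \<Rightarrow> 'a set \<Rightarrow> ('a \<Rightarrow> 'a \<Rightarrow> real) \<Rightarrow> bool" where
  "urysohn_space D M d \<longleftrightarrow>
     metric_on M d \<and> countable M \<and> homogeneous M d \<and> dist_set M d = D \<and>
     (\<forall>(F::nat set) dF. finite F \<and> metric_on F dF \<and> dist_set F dF \<subseteq> D \<longrightarrow>
        (\<exists>f. isometric_embedding F dF M d f))"

definition universal_dist_set :: "real set \<Rightarrow> bool" where
  "universal_dist_set D \<longleftrightarrow> (\<exists>(M::nat set) d. urysohn_space D M d)"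

end

theory Submission
  imports Defs
begin

text \<open>
  Words over \<open>D\<close> are made into a metric space as follows. Join \<open>u\<close> to a longer word \<open>v\<close> by an edge
  of length \<open>c\<close> if \<open>0\<close> occurs in \<open>u\<close> and every \<open>u ! i\<close>, \<open>v ! i\<close>, \<open>c\<close> satisfy the triangle
  inequalities, and take the path metric with respect to \<open>a \<oplus> b = Max {c \<in> D. c \<le> a + b}\<close>, which is
  associative because \<open>D\<close> is universal. Edges keep their length, and the countable space of words
  embeds into \<open>M\<close>; so a colouring of \<open>M\<close> induces one of the words.

  Enumerate \<open>M\<close> as \<open>e 0, e 1, \<dots>\<close> and code \<open>e n\<close> by its distances to the earlier points, each repeated
  after truncation from below by every element of \<open>D\<close> in descending order. In such a word the elements of
  \<open>D - {0}\<close> first occur in descending order. A Carlson--Simpson type theorem yields a substitution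
  that keeps every letter at some position, inserts only copies of earlier letters and of \<open>Max D\<close>, and
  makes the colour constant on all words of this kind. As neither insertion violates a triangle
  inequality, \<open>e i\<close> and \<open>e n\<close> are sent to words joined by an edge of length \<open>d (e i) (e n)\<close>, the
  letter \<open>0\<close> appended to the first being matched by the letter of the second that codes this distance.
\<close>

section \<open>The semigroup of ultrafilters on words\<close>

definition ultra :: "'b filter \<Rightarrow> bool" where
  "ultra U \<longleftrightarrow> U \<noteq> bot \<and> (\<forall>P. eventually P U \<or> eventually (\<lambda>x. \<not> P x) U)"

lemma eventually_Inf_chain:
  fixes C :: "'b filter set"
  assumes "C \<noteq> {}" and "\<And>F G. F \<in> C \<Longrightarrow> G \<in> C \<Longrightarrow> F \<le> G \<or> G \<le> F"
  shows "eventually P (Inf C) \<longleftrightarrow> (\<exists>F\<in>C. eventually P F)"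
proof (rule eventually_Inf_base[OF assms(1)])
  fix F G assume "F \<in> C" "G \<in> C"
  with assms(2)[of F G] show "\<exists>x\<in>C. x \<le> inf F G"
    by (metis inf.absorb1 inf.absorb2 order_refl)
qed

text \<open>Zorn's lemma for decreasing chains. It yields ultrafilters, minimal closed subsemigroups
  and minimal closed left ideals.\<close>

lemma minimal_filter_exists:
  fixes K :: "'b filter set"
  assumes "F0 \<in> K"
    and chain: "\<And>C. \<lbrakk>C \<noteq> {}; C \<subseteq> K; \<And>F G. F \<in> C \<Longrightarrow> G \<in> C \<Longrightarrow> F \<le> G \<or> G \<le> F\<rbrakk> \<Longrightarrow> Inf C \<in> K"
  obtains F where "F \<in> K" "\<And>G. G \<in> K \<Longrightarrow> G \<le> F \<Longrightarrow> G = F"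
proof -
  have "\<exists>m\<in>K. \<forall>a\<in>K. a \<le> m \<longrightarrow> a = m"
  proof (rule predicate_Zorn[where P = "\<lambda>a b. b \<le> a"])
    show "partial_order_on K (relation_of (\<lambda>a b. b \<le> a) K)"
      by (rule partial_order_on_relation_ofI) auto
    fix C assume C: "C \<in> Chains (relation_of (\<lambda>a b. b \<le> a) K)"
    then have sub: "C \<subseteq> K" by (auto simp: Chains_def relation_of_def)
    have lin: "F \<le> G \<or> G \<le> F" if "F \<in> C" "G \<in> C" for F G
      using C that by (auto simp: Chains_def relation_of_def)
    show "\<exists>u\<in>K. \<forall>a\<in>C. u \<le> a"
    proof (cases "C = {}")
      case True then show ?thesis using assms(1) by auto
    next
      case False
      then show ?thesis using chain[OF False sub lin] by (meson Inf_lower)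
    qed
  qed
  then show ?thesis using that by blast
qed

lemma ultra_exists:
  fixes F :: "'b filter"
  assumes "F \<noteq> bot"
  obtains U where "ultra U" "U \<le> F"
proof -
  obtain U where U: "U \<in> {G. G \<noteq> bot \<and> G \<le> F}"
    and min: "\<And>G. G \<in> {G. G \<noteq> bot \<and> G \<le> F} \<Longrightarrow> G \<le> U \<Longrightarrow> G = U"
  proof (rule minimal_filter_exists[of F "{G. G \<noteq> bot \<and> G \<le> F}"])
    show "F \<in> {G. G \<noteq> bot \<and> G \<le> F}" using assms by simp
    fix C :: "'b filter set"
    assume C: "C \<noteq> {}" "C \<subseteq> {G. G \<noteq> bot \<and> G \<le> F}"
      and lin: "\<And>F G. F \<in> C \<Longrightarrow> G \<in> C \<Longrightarrow> F \<le> G \<or> G \<le> F"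
    have "\<not> eventually (\<lambda>_. False) (Inf C)"
      using C eventually_Inf_chain[OF C(1) lin] by (auto simp: trivial_limit_def)
    moreover have "Inf C \<le> F" using C by (metis (no_types, lifting) Inf_lower2 ex_in_conv mem_Collect_eq subsetD)
    ultimately show "Inf C \<in> {G. G \<noteq> bot \<and> G \<le> F}" by (simp add: trivial_limit_def)
  qed auto
  have "eventually P U \<or> eventually (\<lambda>x. \<not> P x) U" for P
  proof (rule ccontr)
    assume a: "\<not> (eventually P U \<or> eventually (\<lambda>x. \<not> P x) U)"
    let ?G = "inf U (principal {x. P x})"
    have "?G \<noteq> bot"
      using a by (simp add: trivial_limit_def eventually_inf_principal)
    then have "?G = U" using U by (intro min) (auto intro: le_infI1)
    moreover have "eventually P ?G" by (simp add: eventually_inf_principal)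
    ultimately show False using a by simp
  qed
  then show ?thesis using U that by (auto simp: ultra_def)
qed

lemma ultra_not:
  assumes "ultra U"
  shows "eventually (\<lambda>x. \<not> P x) U \<longleftrightarrow> \<not> eventually P U"
proof
  assume "eventually (\<lambda>x. \<not> P x) U"
  show "\<not> eventually P U"
  proof
    assume "eventually P U"
    with \<open>eventually (\<lambda>x. \<not> P x) U\<close> have "eventually (\<lambda>_. False) U" by eventually_elim simp
    then show False using assms by (simp add: ultra_def)
  qed
qed (use assms in \<open>auto simp: ultra_def\<close>)

lemma ultra_eq: "\<lbrakk>ultra U; V \<le> U; V \<noteq> bot\<rbrakk> \<Longrightarrow> V = U"
proof (rule antisym)
  assume U: "ultra U" and V: "V \<le> U" "V \<noteq> bot"
  show "U \<le> V"
  proof (rule filter_leI)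
    fix P assume P: "eventually P V"
    show "eventually P U"
    proof (rule ccontr)
      assume "\<not> eventually P U"
      then have "eventually (\<lambda>x. \<not> P x) V" using U V(1) ultra_not[OF U] by (metis filter_leD)
      with P have "eventually (\<lambda>_. False) V" by eventually_elim simp
      then show False using V(2) by (simp add: trivial_limit_def)
    qed
  qed
qed

text \<open>If \<open>P\<close> is eventual in \<open>G\<close> but not in \<open>F\<close>, then
  \<open>F\<close> is compatible with the complement of \<open>P\<close>, and an ultrafilter
  refining both is below \<open>F\<close> but not below \<open>G\<close>.\<close>

lemma filter_le_ultra:
  assumes "\<And>U. ultra U \<Longrightarrow> U \<le> F \<Longrightarrow> U \<le> G"
  shows "F \<le> G"
proof (rule filter_leI, rule ccontr)
  fix P assume P: "eventually P G" "\<not> eventually P F"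
  have "inf F (principal {x. \<not> P x}) \<noteq> bot"
    using P(2) by (simp add: trivial_limit_def eventually_inf_principal)
  then obtain U where U: "ultra U" "U \<le> inf F (principal {x. \<not> P x})" by (rule ultra_exists)
  then have "eventually P U" using assms P(1) filter_leD by (metis le_inf_iff)
  moreover have "eventually (\<lambda>x. \<not> P x) U" using U(2) by (simp add: le_principal)
  ultimately show False using ultra_not[OF U(1)] by blast
qed

lemma ultra_filtermap: "ultra U \<Longrightarrow> ultra (filtermap f U)"
  by (auto simp: ultra_def eventually_filtermap filtermap_bot_iff)

text \<open>The Fubini product; on ultrafilters it extends concatenation to the Stone-Cech
  compactification of the free monoid and is continuous in the first argument.\<close>

definition conc :: "'b list filter \<Rightarrow> 'b list filter \<Rightarrow> 'b list filter" where
  "conc F G = Abs_filter (\<lambda>P. \<forall>\<^sub>F x in F. \<forall>\<^sub>F y in G. P (x @ y))"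

lemma eventually_conc: "eventually P (conc F G) \<longleftrightarrow> (\<forall>\<^sub>F x in F. \<forall>\<^sub>F y in G. P (x @ y))"
  unfolding conc_def
proof (rule eventually_Abs_filter, rule is_filter.intro, goal_cases)
  case (2 P Q)
  then show ?case by eventually_elim (rule eventually_conj)
next
  case (3 P Q)
  from 3(2) show ?case by eventually_elim (use 3(1) in \<open>auto elim: eventually_mono\<close>)
qed simp

lemma conc_assoc: "conc (conc F G) H = conc F (conc G H)"
  by (simp add: filter_eq_iff eventually_conc)

lemma conc_mono: "F \<le> F' \<Longrightarrow> G \<le> G' \<Longrightarrow> conc F G \<le> conc F' G'"
proof (rule filter_leI)
  fix P assume le: "F \<le> F'" "G \<le> G'" and "eventually P (conc F' G')"
  then have "\<forall>\<^sub>F x in F. \<forall>\<^sub>F y in G'. P (x @ y)" by (simp add: eventually_conc filter_leD[OF le(1)])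
  then show "eventually P (conc F G)" unfolding eventually_conc
    by eventually_elim (rule filter_leD[OF le(2)])
qed

lemma conc_not_bot: "F \<noteq> bot \<Longrightarrow> G \<noteq> bot \<Longrightarrow> conc F G \<noteq> bot"
  by (simp add: trivial_limit_def eventually_conc)

lemma ultra_conc:
  assumes "ultra U" "ultra V"
  shows "ultra (conc U V)"
proof -
  have "eventually (\<lambda>w. \<not> P w) (conc U V)" if "\<not> eventually P (conc U V)" for P
    using that by (simp add: eventually_conc flip: ultra_not[OF assms(1)] ultra_not[OF assms(2)])
  then show ?thesis using assms conc_not_bot by (auto simp: ultra_def)
qed

text \<open>By continuity, multiplication by \<open>V\<close> from the right maps the compact set
  represented by \<open>F\<close> onto a closed set; \<open>conc F V\<close> represents this
  image.\<close>

lemma ultra_le_conc: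
  assumes V: "ultra V" and W: "ultra W" "W \<le> conc F V"
  obtains U where "ultra U" "U \<le> F" "conc U V = W"
proof -
  \<comment> \<open>\<open>G\<close> is generated by the preimages of the members of
    \<open>W\<close>. Were it incompatible with \<open>F\<close>, the complement of some member of
    \<open>W\<close> would be eventual in \<open>conc F V\<close>.\<close>
  define G where "G = (INF P\<in>{P. eventually P W}. principal {x. \<forall>\<^sub>F y in V. P (x @ y)})"
  have G: "eventually Q G \<longleftrightarrow> (\<exists>P. eventually P W \<and> (\<forall>x. (\<forall>\<^sub>F y in V. P (x @ y)) \<longrightarrow> Q x))" for Q
    unfolding G_def
  proof (subst eventually_INF_base, goal_cases)
    case 1 show ?case by (auto intro: exI[of _ "\<lambda>_. True"])
  next
    case (2 P Q)
    then show ?case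
      by (intro bexI[of _ "\<lambda>x. P x \<and> Q x"]) (auto intro: eventually_conj elim: eventually_mono)
  qed (auto simp: eventually_principal)
  have "inf F G \<noteq> bot"
  proof
    assume "inf F G = bot"
    then have "eventually (\<lambda>_. False) (inf F G)" by simp
    then obtain A B where AB: "eventually A F" "eventually B G" "\<And>x. A x \<Longrightarrow> B x \<Longrightarrow> False"
      unfolding eventually_inf by blast
    then obtain P where P: "eventually P W" "\<And>x. (\<forall>\<^sub>F y in V. P (x @ y)) \<Longrightarrow> B x" using G by blast
    have "\<forall>\<^sub>F x in F. \<forall>\<^sub>F y in V. \<not> P (x @ y)"
      using AB(1) by eventually_elim (use AB(3) P(2) in \<open>auto simp: ultra_not[OF V]\<close>)
    then have "eventually (\<lambda>x. \<not> P x) W"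
      using filter_leD[OF W(2)] by (simp add: eventually_conc)
    then show False using P(1) ultra_not[OF W(1)] by blast
  qed
  then obtain U where U: "ultra U" "U \<le> inf F G" by (rule ultra_exists)
  have "conc U V \<le> W"
  proof (rule filter_leI)
    fix P assume "eventually P W"
    then have "eventually (\<lambda>x. \<forall>\<^sub>F y in V. P (x @ y)) G" using G by blast
    then show "eventually P (conc U V)" using U(2) by (auto simp: eventually_conc dest: filter_leD)
  qed
  then have "conc U V = W" using ultra_eq[OF W(1)] ultra_conc[OF U(1) V] by (auto simp: ultra_def)
  then show ?thesis using that[OF U(1)] U(2) by auto
qed

text \<open>Closed sets of ultrafilters are represented by filters: \<open>F\<close> stands for the set of all ultrafilters
  \<open>U \<le> F\<close>. Closed subsemigroups and closed left ideals thus become filters.\<close>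

definition subsemi :: "'b list filter \<Rightarrow> bool" where
  "subsemi F \<longleftrightarrow> F \<noteq> bot \<and>
     (\<forall>U V. ultra U \<and> U \<le> F \<and> ultra V \<and> V \<le> F \<longrightarrow> conc U V \<le> F)"

definition left_ideal :: "'b list filter \<Rightarrow> 'b list filter \<Rightarrow> bool" where
  "left_ideal A L \<longleftrightarrow> L \<noteq> bot \<and> L \<le> A \<and>
     (\<forall>U V. ultra U \<and> U \<le> A \<and> ultra V \<and> V \<le> L \<longrightarrow> conc U V \<le> L)"

section \<open>Idempotents and minimal left ideals\<close>

lemma Inf_chain_not_bot:
  fixes C :: "'b filter set"
  assumes "C \<noteq> {}" "\<And>F G. F \<in> C \<Longrightarrow> G \<in> C \<Longrightarrow> F \<le> G \<or> G \<le> F" "bot \<notin> C"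
  shows "Inf C \<noteq> bot"
  using assms by (metis eventually_Inf_chain trivial_limit_def)

text \<open>Ellis-Numakura lemma. In a minimal closed subsemigroup \<open>F\<close> take any
  \<open>e\<close>. First \<open>conc F e\<close> is a closed subsemigroup, hence \<open>F\<close>;
  so some \<open>U\<close> in \<open>F\<close> satisfies \<open>conc U e = e\<close>. All such
  \<open>U\<close> again form a closed subsemigroup, hence \<open>F\<close>, and \<open>e\<close> is
  among them.\<close>

lemma subsemi_idempotent:
  fixes F0 :: "'b list filter"
  assumes "subsemi F0"
  obtains e where "ultra e" "e \<le> F0" "conc e e = e"
proof -
  let ?K = "{F. subsemi F \<and> F \<le> F0}"
  obtain F where F: "F \<in> ?K" and min: "\<And>G. G \<in> ?K \<Longrightarrow> G \<le> F \<Longrightarrow> G = F"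
  proof (rule minimal_filter_exists[of F0 ?K])
    fix C :: "'b list filter set"
    assume C: "C \<noteq> {}" "C \<subseteq> ?K"
      and lin: "\<And>F G. F \<in> C \<Longrightarrow> G \<in> C \<Longrightarrow> F \<le> G \<or> G \<le> F"
    have "Inf C \<noteq> bot" using C Inf_chain_not_bot[OF C(1) lin] by (auto simp: subsemi_def)
    moreover have "conc U V \<le> Inf C" if "ultra U" "U \<le> Inf C" "ultra V" "V \<le> Inf C" for U V
      using that C by (auto simp: subsemi_def le_Inf_iff subset_iff)
    moreover have "Inf C \<le> F0" using C by (auto intro: Inf_lower2)
    ultimately show "Inf C \<in> ?K" by (simp add: subsemi_def)
  qed (use assms in auto)
  have Fbot: "F \<noteq> bot" and Fsemi: "\<And>U V. ultra U \<Longrightarrow> U \<le> F \<Longrightarrow> ultra V \<Longrightarrow> V \<le> F \<Longrightarrow> conc U V \<le> F"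
    and FF0: "F \<le> F0" using F by (auto simp: subsemi_def)
  obtain e where e: "ultra e" "e \<le> F" using Fbot by (rule ultra_exists)
  have le: "conc F e \<le> F"
  proof (rule filter_le_ultra)
    fix W assume "ultra W" "W \<le> conc F e"
    then obtain U where "ultra U" "U \<le> F" "conc U e = W" using ultra_le_conc[OF e(1)] by metis
    then show "W \<le> F" using Fsemi e by blast
  qed
  have "conc F e = F"
  proof (rule min[OF _ le])
    have "conc F e \<noteq> bot" using conc_not_bot[OF Fbot] e(1) by (simp add: ultra_def)
    moreover have "conc U V \<le> conc F e"
      if U: "ultra U" "U \<le> conc F e" and V: "ultra V" "V \<le> conc F e" for U V
    proof -
      obtain V' where V': "ultra V'" "V' \<le> F" "conc V' e = V"
        using ultra_le_conc[OF e(1) V] by metis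
      have "conc U V' \<le> F" using Fsemi U V' le by (meson order_trans)
      then have "conc (conc U V') e \<le> conc F e" by (rule conc_mono) simp
      then show ?thesis using V' by (simp add: conc_assoc)
    qed
    ultimately show "conc F e \<in> ?K" using le FF0 by (auto simp: subsemi_def)
  qed
  then obtain U0 where U0: "ultra U0" "U0 \<le> F" "conc U0 e = e"
    using ultra_le_conc[OF e(1) e(1), of F] e(2) by metis
  define G where "G = Sup {U. ultra U \<and> U \<le> F \<and> conc U e = e}"
  \<comment> \<open>A supremum of ultrafilters represents the closure of their set. By continuity in
    the first argument the equation survives in the closure.\<close>
  have Gmem: "conc U e = e" if "ultra U" "U \<le> G" for U
  proof -
    have "conc U e \<le> e"
    proof (rule filter_leI)
      fix P assume P: "eventually P e"
      have "\<forall>\<^sub>F x in V. \<forall>\<^sub>F y in e. P (x @ y)" if "conc V e = e" for V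
        using P eventually_conc[of P V e] that by simp
      then have "\<forall>\<^sub>F x in G. \<forall>\<^sub>F y in e. P (x @ y)" by (simp add: G_def eventually_Sup)
      then show "eventually P (conc U e)" using that(2) by (auto simp: eventually_conc dest: filter_leD)
    qed
    then show ?thesis using ultra_eq[OF e(1)] ultra_conc[OF that(1) e(1)] by (auto simp: ultra_def)
  qed
  have GF: "G \<le> F" by (auto simp: G_def intro: Sup_least)
  have U0G: "U0 \<le> G" using U0 by (auto simp: G_def intro: Sup_upper)
  have "G = F"
  proof (rule min[OF _ GF])
    have "G \<noteq> bot" using U0G U0(1) by (auto simp: ultra_def bot_unique)
    moreover have "conc U V \<le> G" if U: "ultra U" "U \<le> G" and V: "ultra V" "V \<le> G" for U V
    proof -
      have "conc (conc U V) e = e" using Gmem[OF U] Gmem[OF V] by (simp add: conc_assoc)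
      moreover have "conc U V \<le> F" using Fsemi U V GF by (meson order_trans)
      ultimately show ?thesis using ultra_conc[OF U(1) V(1)] by (auto simp: G_def intro: Sup_upper)
    qed
    ultimately show "G \<in> ?K" using GF FF0 by (auto simp: subsemi_def)
  qed
  then have "conc e e = e" using Gmem e by simp
  then show ?thesis using that e FF0 by (meson order_trans)
qed

lemma minimal_left_ideal:
  fixes A :: "'a list filter"
  assumes "subsemi A"
  obtains L where "left_ideal A L" "\<And>L'. left_ideal A L' \<Longrightarrow> L' \<le> L \<Longrightarrow> L' = L"
proof -
  obtain L where "L \<in> Collect (left_ideal A)"
    "\<And>L'. L' \<in> Collect (left_ideal A) \<Longrightarrow> L' \<le> L \<Longrightarrow> L' = L"
  proof (rule minimal_filter_exists[of A "Collect (left_ideal A)"])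
    show "A \<in> Collect (left_ideal A)" using assms by (auto simp: subsemi_def left_ideal_def)
    fix C :: "'a list filter set"
    assume C: "C \<noteq> {}" "C \<subseteq> Collect (left_ideal A)"
      and lin: "\<And>F G. F \<in> C \<Longrightarrow> G \<in> C \<Longrightarrow> F \<le> G \<or> G \<le> F"
    have "bot \<notin> C" using C(2) by (auto simp: left_ideal_def)
    then have "Inf C \<noteq> bot" using Inf_chain_not_bot[OF C(1) lin] by blast
    moreover have "conc U V \<le> Inf C" if "ultra U" "U \<le> A" "ultra V" "V \<le> Inf C" for U V
      using that C by (auto simp: left_ideal_def le_Inf_iff subset_iff)
    moreover obtain F where "F \<in> C" using C(1) by blast
    moreover from this have "F \<le> A" using C(2) by (auto simp: left_ideal_def)
    then have "Inf C \<le> A" using \<open>F \<in> C\<close> by (rule Inf_lower2[rotated])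
    ultimately show "Inf C \<in> Collect (left_ideal A)" by (simp add: left_ideal_def)
  qed auto
  then show ?thesis using that by auto
qed

text \<open>\<open>conc A e\<close> is a left ideal below \<open>L\<close>, hence equal to
  \<open>L\<close>. So \<open>w\<close> has the form \<open>conc U e\<close>, and a further factor
  \<open>e\<close> changes nothing.\<close>

lemma minimal_left_ideal_absorb:
  assumes A: "subsemi A" and L: "left_ideal A L"
    and min: "\<And>L'. left_ideal A L' \<Longrightarrow> L' \<le> L \<Longrightarrow> L' = L"
    and e: "ultra e" "e \<le> L" "conc e e = e" and w: "ultra w" "w \<le> L"
  shows "conc w e = w"
proof -
  have LA: "L \<le> A" and Lid: "\<And>U V. ultra U \<Longrightarrow> U \<le> A \<Longrightarrow> ultra V \<Longrightarrow> V \<le> L \<Longrightarrow> conc U V \<le> L"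
    using L by (auto simp: left_ideal_def)
  have Asemi: "\<And>U V. ultra U \<Longrightarrow> U \<le> A \<Longrightarrow> ultra V \<Longrightarrow> V \<le> A \<Longrightarrow> conc U V \<le> A" and Abot: "A \<noteq> bot"
    using A by (auto simp: subsemi_def)
  have le: "conc A e \<le> L"
  proof (rule filter_le_ultra)
    fix W assume "ultra W" "W \<le> conc A e"
    then obtain U where "ultra U" "U \<le> A" "conc U e = W" using ultra_le_conc[OF e(1)] by metis
    then show "W \<le> L" using Lid e by blast
  qed
  have "conc A e = L"
  proof (rule min[OF _ le])
    have "conc A e \<noteq> bot" using conc_not_bot[OF Abot] e(1) by (simp add: ultra_def)
    moreover have "conc U V \<le> conc A e"
      if U: "ultra U" "U \<le> A" and V: "ultra V" "V \<le> conc A e" for U V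
    proof -
      obtain V' where V': "ultra V'" "V' \<le> A" "conc V' e = V"
        using ultra_le_conc[OF e(1) V] by metis
      have "conc U V' \<le> A" using Asemi U V' by blast
      then have "conc (conc U V') e \<le> conc A e" by (rule conc_mono) simp
      then show ?thesis using V' by (simp add: conc_assoc)
    qed
    ultimately show "left_ideal A (conc A e)" using le LA by (auto simp: left_ideal_def)
  qed
  then obtain U where "conc U e = w" using ultra_le_conc[OF e(1) w(1), of A] w(2) by metis
  then show ?thesis using e(3) conc_assoc by metis
qed

section \<open>Canonical colourings of words\<close>

text \<open>\<open>None\<close> is the variable; the variable words in \<open>lvar C\<close> begin with it.\<close>

definition subst :: "'a \<Rightarrow> 'a option list \<Rightarrow> 'a list" where
  "subst a = map (case_option a id)"

definition lvar :: "'a set \<Rightarrow> 'a option list set" where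
  "lvar C = {y. y \<noteq> [] \<and> hd y = None \<and> set y \<subseteq> insert None (Some ` C)}"

lemma subst_append [simp]: "subst a (x @ y) = subst a x @ subst a y"
  by (simp add: subst_def)

lemma subst_lists: "a \<in> C \<Longrightarrow> y \<in> lvar C \<Longrightarrow> subst a y \<in> lists C"
  by (fastforce simp: subst_def lvar_def split: option.splits)

lemma filtermap_subst_conc:
  "filtermap (subst a) (conc U V) = conc (filtermap (subst a) U) (filtermap (subst a) V)"
  by (simp add: filter_eq_iff eventually_filtermap eventually_conc)

text \<open>\<open>w\<close> is taken in a minimal left ideal \<open>L\<close>, and \<open>v\<close>
  is an idempotent all of whose instances \<open>filtermap (subst a) v\<close> lie in
  \<open>L\<close>. These instances are idempotents of \<open>L\<close>, hence right identities for
  \<open>w\<close> and for each other.\<close>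

lemma left_variable_ultrafilter:
  fixes C :: "'a set"
  assumes "C \<noteq> {}"
  obtains w v where "ultra w" "ultra v" "w \<le> principal (lists C)" "v \<le> principal (lvar C)"
    "\<And>a. a \<in> C \<Longrightarrow> conc w (filtermap (subst a) v) = w"
    "\<And>a b. a \<in> C \<Longrightarrow> b \<in> C \<Longrightarrow>
       conc (filtermap (subst a) v) (filtermap (subst b) v) = filtermap (subst a) v"
proof -
  define A where "A = principal (lists C)"
  have A: "subsemi A"
  proof -
    have "conc A A \<le> A" by (simp add: A_def le_principal eventually_conc eventually_principal)
    then have "conc U V \<le> A" if "U \<le> A" "V \<le> A" for U V using conc_mono[OF that] by (meson order_trans)
    moreover have "A \<noteq> bot" by (auto simp: A_def principal_eq_bot_iff)
    ultimately show ?thesis by (auto simp: subsemi_def)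
  qed
  obtain L where L: "left_ideal A L" and min: "\<And>L'. left_ideal A L' \<Longrightarrow> L' \<le> L \<Longrightarrow> L' = L"
    using minimal_left_ideal[OF A] by blast
  have LA: "L \<le> A" and Lid: "\<And>U V. ultra U \<Longrightarrow> U \<le> A \<Longrightarrow> ultra V \<Longrightarrow> V \<le> L \<Longrightarrow> conc U V \<le> L"
    and "L \<noteq> bot" using L by (auto simp: left_ideal_def)
  obtain w where w: "ultra w" "w \<le> L" using \<open>L \<noteq> bot\<close> by (rule ultra_exists)
  define Q where "Q = inf (principal (lvar C)) (INF a\<in>C. filtercomap (subst a) L)"
  have Q: "U \<le> Q \<longleftrightarrow> U \<le> principal (lvar C) \<and> (\<forall>a\<in>C. filtermap (subst a) U \<le> L)" for U
    by (simp add: Q_def le_INF_iff filtermap_le_iff_le_filtercomap)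
  have lvarA: "filtermap (subst a) U \<le> A" if "a \<in> C" "U \<le> principal (lvar C)" for a U
    using that subst_lists[OF that(1)]
    by (auto simp: A_def le_principal eventually_filtermap elim!: eventually_mono)
  \<comment> \<open>\<open>V\<close> may concentrate on words without the variable. The same fact
    thus gives closure of \<open>Q\<close> under products and, with constant words on the right, an
    element of \<open>Q\<close>.\<close>
  have semi: "conc U V \<le> Q" if U: "ultra U" "U \<le> principal (lvar C)" and V: "ultra V"
    "V \<le> principal {y. set y \<subseteq> insert None (Some ` C)}" "\<forall>a\<in>C. filtermap (subst a) V \<le> L" for U V
  proof -
    have "\<forall>\<^sub>F x in U. \<forall>\<^sub>F y in V. x @ y \<in> lvar C"
    proof -
      have "\<forall>\<^sub>F x in U. x \<in> lvar C" "\<forall>\<^sub>F y in V. set y \<subseteq> insert None (Some ` C)"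
        using U V by (auto simp: le_principal)
      then show ?thesis
        by (auto simp: lvar_def elim!: eventually_mono)
    qed
    moreover have "filtermap (subst a) (conc U V) \<le> L" if "a \<in> C" for a
      unfolding filtermap_subst_conc
      using Lid U V that lvarA[OF that U(2)] by (simp add: ultra_filtermap)
    ultimately show ?thesis by (simp add: Q le_principal eventually_conc)
  qed
  have "subsemi Q"
  proof -
    have "principal (lvar C) \<noteq> bot"
      by (auto simp: principal_eq_bot_iff lvar_def intro!: exI[of _ "[None]"])
    then obtain v0 where v0: "ultra v0" "v0 \<le> principal (lvar C)" by (rule ultra_exists)
    \<comment> \<open>A copy of \<open>w\<close> on words without the variable: every substitution
      gives back \<open>w\<close>, which lies in \<open>L\<close>.\<close>
    define w' where "w' = filtermap (map Some) w"
    have "ultra w'" using w by (simp add: w'_def ultra_filtermap)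
    moreover have "w' \<le> principal {y. set y \<subseteq> insert None (Some ` C)}"
    proof -
      have "\<forall>\<^sub>F x in w. x \<in> lists C" using order_trans[OF w(2) LA] by (simp add: A_def le_principal)
      then show ?thesis by (auto simp: w'_def le_principal eventually_filtermap elim!: eventually_mono)
    qed
    moreover have "filtermap (subst a) w' = w" for a
    proof -
      have "subst a (map Some u) = u" for u by (simp add: subst_def comp_def)
      then show ?thesis by (simp add: w'_def filtermap_filtermap)
    qed
    ultimately have "conc v0 w' \<le> Q" using w by (intro semi v0) auto
    moreover have "conc v0 w' \<noteq> bot" using ultra_conc[OF v0(1) \<open>ultra w'\<close>] by (simp add: ultra_def)
    ultimately have "Q \<noteq> bot" by (metis bot_unique)
    moreover have "conc U V \<le> Q" if "ultra U" "U \<le> Q" "ultra V" "V \<le> Q" for U V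
    proof (rule semi)
      have "principal (lvar C) \<le> principal {y. set y \<subseteq> insert None (Some ` C)}"
        by (auto simp: lvar_def)
      then show "V \<le> principal {y. set y \<subseteq> insert None (Some ` C)}"
        using that Q by (meson order_trans)
    qed (use that Q in auto)
    ultimately show ?thesis by (auto simp: subsemi_def)
  qed
  then obtain v where v: "ultra v" "v \<le> Q" "conc v v = v" by (rule subsemi_idempotent)
  have idem: "conc (filtermap (subst a) v) (filtermap (subst a) v) = filtermap (subst a) v" for a
    using v(3) by (metis filtermap_subst_conc)
  have absorb: "conc x (filtermap (subst a) v) = x" if "a \<in> C" "ultra x" "x \<le> L" for a x
    using minimal_left_ideal_absorb[OF A L min _ _ idem that(2,3)] v Q that(1)
    by (simp add: ultra_filtermap)
  show ?thesis
  proof (rule that[OF w(1) v(1)])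
    show "w \<le> principal (lists C)" using w(2) LA by (simp add: A_def)
    show "v \<le> principal (lvar C)" using v(2) Q by blast
    show "conc w (filtermap (subst a) v) = w" if "a \<in> C" for a using absorb that w by blast
    show "conc (filtermap (subst a) v) (filtermap (subst b) v) = filtermap (subst a) v"
      if "a \<in> C" "b \<in> C" for a b using absorb[OF that(2)] that v Q by (simp add: ultra_filtermap)
  qed
qed

text \<open>The Carlson-Simpson theorem for a fixed alphabet. The variable words are chosen one
  after another; by the equations for \<open>w\<close> and \<open>v\<close>, almost every choice
  keeps all words built so far extendable in the colour \<open>c\<close>.\<close>

lemma infinite_Hales_Jewett:
  fixes C :: "'a set" and color :: "'a list \<Rightarrow> bool"
  assumes "finite C" "C \<noteq> {}"
  obtains s0 Y c where "s0 \<in> lists C" "\<And>n. Y n \<in> lvar C"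
    "\<And>u. u \<in> lists C \<Longrightarrow> color (s0 @ concat (map (\<lambda>i. subst (u ! i) (Y i)) [0..<length u])) = c"
proof -
  obtain w v where w: "ultra w" and v: "ultra v" and wC: "w \<le> principal (lists C)"
    and vC: "v \<le> principal (lvar C)"
    and wv: "\<And>a. a \<in> C \<Longrightarrow> conc w (filtermap (subst a) v) = w"
    and vv: "\<And>a b. a \<in> C \<Longrightarrow> b \<in> C \<Longrightarrow>
       conc (filtermap (subst a) v) (filtermap (subst b) v) = filtermap (subst a) v"
    using left_variable_ultrafilter[OF assms(2)] by metis
  obtain c where c: "\<forall>\<^sub>F s in w. color s = c"
  proof (cases "eventually color w")
    case True then show ?thesis using that[of True] by simp
  next
    case False then show ?thesis using that[of False] ultra_not[OF w] by simp
  qed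
  define good where "good s \<longleftrightarrow> color s = c \<and> (\<forall>a\<in>C. \<forall>\<^sub>F y in v. color (s @ subst a y) = c)" for s
  have "\<forall>\<^sub>F s in w. \<forall>\<^sub>F y in v. color (s @ subst a y) = c" if "a \<in> C" for a
  proof -
    have "\<forall>\<^sub>F s in conc w (filtermap (subst a) v). color s = c" using c wv[OF that] by simp
    then show ?thesis by (simp add: eventually_conc eventually_filtermap)
  qed
  then have "\<forall>\<^sub>F s in w. \<forall>a\<in>C. \<forall>\<^sub>F y in v. color (s @ subst a y) = c"
    using assms(1) by (simp add: eventually_ball_finite)
  with c have "\<forall>\<^sub>F s in w. good s" unfolding good_def by eventually_elim simp
  moreover have "\<forall>\<^sub>F s in w. s \<in> lists C" using wC by (simp add: le_principal)
  ultimately have "\<forall>\<^sub>F s in w. good s \<and> s \<in> lists C" by (rule eventually_conj)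
  then obtain s0 where s0: "good s0" "s0 \<in> lists C"
    using w by (auto simp: ultra_def dest!: eventually_happens)
  \<comment> \<open>Rewriting the instance of \<open>v\<close> at \<open>a\<close> as its product
    with the instance at \<open>b\<close> turns the condition on one extension into one on two
    successive extensions.\<close>
  have good_step: "\<forall>\<^sub>F y in v. good (s @ subst a y)" if s: "good s" and a: "a \<in> C" for s a
  proof -
    have 1: "\<forall>\<^sub>F y in v. color (s @ subst a y) = c" using that by (simp add: good_def)
    have "\<forall>\<^sub>F y in v. \<forall>\<^sub>F y' in v. color ((s @ subst a y) @ subst b y') = c" if b: "b \<in> C" for b
    proof -
      have "\<forall>\<^sub>F t in filtermap (subst a) v. color (s @ t) = c" using 1 by (simp add: eventually_filtermap)
      then have "\<forall>\<^sub>F t in conc (filtermap (subst a) v) (filtermap (subst b) v). color (s @ t) = c"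
        using vv[OF a b] by simp
      then show ?thesis by (simp add: eventually_conc eventually_filtermap)
    qed
    then have "\<forall>\<^sub>F y in v. \<forall>b\<in>C. \<forall>\<^sub>F y' in v. color ((s @ subst a y) @ subst b y') = c"
      using assms(1) by (simp add: eventually_ball_finite)
    with 1 show ?thesis unfolding good_def by eventually_elim simp
  qed
  have step: "\<exists>y. y \<in> lvar C \<and> (\<forall>s\<in>P. \<forall>a\<in>C. good (s @ subst a y))"
    if "finite P" "\<forall>s\<in>P. good s" for P
  proof -
    have "\<forall>\<^sub>F y in v. \<forall>s\<in>P. \<forall>a\<in>C. good (s @ subst a y)"
      using that assms(1) good_step by (simp add: eventually_ball_finite)
    moreover have "\<forall>\<^sub>F y in v. y \<in> lvar C" using vC by (simp add: le_principal)
    ultimately have "\<forall>\<^sub>F y in v. y \<in> lvar C \<and> (\<forall>s\<in>P. \<forall>a\<in>C. good (s @ subst a y))"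
      by eventually_elim simp
    then show ?thesis using v by (auto simp: ultra_def dest!: eventually_happens)
  qed
  then obtain y where y: "\<And>P. finite P \<Longrightarrow> \<forall>s\<in>P. good s \<Longrightarrow>
      y P \<in> lvar C \<and> (\<forall>s\<in>P. \<forall>a\<in>C. good (s @ subst a (y P)))"
    by metis
  \<comment> \<open>\<open>S n\<close> holds all words obtained after \<open>n\<close> choices. It
    is finite, so one variable word serves all of them.\<close>
  define S where "S = rec_nat {s0} (\<lambda>_ P. (\<lambda>(s, a). s @ subst a (y P)) ` (P \<times> C))"
  have S: "finite (S n) \<and> (\<forall>s\<in>S n. good s)" for n
    by (induction n) (use s0 assms(1) y in \<open>auto simp: S_def\<close>)
  define Y where "Y n = y (S n)" for n
  have "s0 @ concat (map (\<lambda>i. subst (u ! i) (Y i)) [0..<n]) \<in> S n" if "set (take n u) \<subseteq> C" "n \<le> length u" for u n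
    using that
  proof (induction n)
    case 0 then show ?case by (simp add: S_def)
  next
    case (Suc n)
    then have "s0 @ concat (map (\<lambda>i. subst (u ! i) (Y i)) [0..<n]) \<in> S n" "u ! n \<in> C"
      by (auto simp: take_Suc_conv_app_nth)
    then have "(s0 @ concat (map (\<lambda>i. subst (u ! i) (Y i)) [0..<n])) @ subst (u ! n) (y (S n)) \<in> S (Suc n)"
      by (auto simp: S_def intro!: image_eqI[where x = "(_, u ! n)"])
    then show ?case by (simp add: Y_def)
  qed
  from this[of "length u" u for u]
  have "color (s0 @ concat (map (\<lambda>i. subst (u ! i) (Y i)) [0..<length u])) = c" if "u \<in> lists C" for u
    using that S by (auto simp: good_def)
  moreover have "Y n \<in> lvar C" for n using S y by (simp add: Y_def)
  ultimately show ?thesis using that s0(2) by blast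
qed

section \<open>Infinite substitutions with constants and copied letters\<close>

text \<open>A pair \<open>J\<close>, \<open>l\<close> describes an infinite sequence of variable words: position \<open>i\<close> of the image of
  a word holds either a constant or a copy of one of its letters. In a \<open>valid\<close> pair the image of a word
  of length \<open>n\<close> has length \<open>l n\<close>, and position \<open>l n\<close> is the first one to hold the \<open>n\<close>-th letter.\<close>

datatype 'a sym = Con 'a | Ref nat

primrec eval_sym :: "'a list \<Rightarrow> 'a sym \<Rightarrow> 'a" where
  "eval_sym u (Con c) = c"
| "eval_sym u (Ref j) = u ! j"

definition app :: "(nat \<Rightarrow> 'a sym) \<Rightarrow> (nat \<Rightarrow> nat) \<Rightarrow> 'a list \<Rightarrow> 'a list" where
  "app J l u = map (\<lambda>i. eval_sym u (J i)) [0..<l (length u)]"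

definition valid :: "'a set \<Rightarrow> (nat \<Rightarrow> 'a sym) \<Rightarrow> (nat \<Rightarrow> nat) \<Rightarrow> bool" where
  "valid C J l \<longleftrightarrow> strict_mono l \<and> (\<forall>n i. i < l n \<longrightarrow> J i \<in> Con ` C \<union> Ref ` {..<n}) \<and>
     (\<forall>n. J (l n) = Ref n)"

text \<open>For distinct \<open>ps\<close> outside \<open>C\<close> the split is at the first
  occurrence of \<open>p\<close>. From there on \<open>p\<close> counts as a further constant, which
  drives the induction on \<open>ps\<close>.\<close>

fun pwords :: "'a set \<Rightarrow> 'a list \<Rightarrow> 'a list set" where
  "pwords C [] = lists C"
| "pwords C (p # ps) = {s @ p # w | s w. s \<in> lists C \<and> w \<in> pwords (insert p C) ps}"

text \<open>The inserted constants come from \<open>C\<close> alone; letters of \<open>ps\<close>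
  are inserted only as copies of letters already seen.\<close>

definition canonizable :: "'a set \<Rightarrow> 'a list \<Rightarrow> bool" where
  "canonizable C ps \<longleftrightarrow> (\<forall>color :: 'a list \<Rightarrow> bool. \<exists>J l c. valid C J l \<and> (\<forall>u\<in>pwords C ps. color (app J l u) = c))"

lemma length_app [simp]: "length (app J l u) = l (length u)"
  by (simp add: app_def)

lemma nth_app: "i < l (length u) \<Longrightarrow> app J l u ! i = eval_sym u (J i)"
  by (simp add: app_def)

lemma valid_less: "valid C J l \<Longrightarrow> l m < l n \<longleftrightarrow> m < n"
  by (simp add: valid_def strict_mono_less)

lemma valid_sym: "valid C J l \<Longrightarrow> i < l n \<Longrightarrow> J i \<in> Con ` C \<union> Ref ` {..<n}"
  by (simp add: valid_def)

lemma valid_Ref: "valid C J l \<Longrightarrow> J (l n) = Ref n"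
  by (simp add: valid_def)

lemma valid_mono: "valid C J l \<Longrightarrow> C \<subseteq> C' \<Longrightarrow> valid C' J l"
  by (fastforce simp: valid_def)

lemma valid_id: "valid C Ref (\<lambda>n. n)"
  by (auto simp: valid_def strict_mono_def)

definition comp_sym :: "(nat \<Rightarrow> 'a sym) \<Rightarrow> (nat \<Rightarrow> 'a sym) \<Rightarrow> nat \<Rightarrow> 'a sym" where
  "comp_sym J K i = (case J i of Con c \<Rightarrow> Con c | Ref j \<Rightarrow> K j)"

lemma valid_comp:
  assumes J: "valid C J l" and K: "valid C K k"
  shows "valid C (comp_sym J K) (l \<circ> k)"
  unfolding valid_def
proof (intro conjI allI impI)
  show "strict_mono (l \<circ> k)" using assms by (auto simp: valid_def strict_mono_def)
  show "comp_sym J K i \<in> Con ` C \<union> Ref ` {..<n}" if "i < (l \<circ> k) n" for i n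
  proof (cases "J i")
    case (Con c)
    then show ?thesis using valid_sym[OF J, of i "k n"] that by (auto simp: comp_sym_def)
  next
    case (Ref j)
    then have "j < k n" using valid_sym[OF J, of i "k n"] that by auto
    then show ?thesis using valid_sym[OF K] Ref by (simp add: comp_sym_def)
  qed
  show "comp_sym J K ((l \<circ> k) n) = Ref n" for n
    by (simp add: comp_sym_def valid_Ref[OF J] valid_Ref[OF K])
qed

lemma app_comp:
  assumes J: "valid C J l"
  shows "app (comp_sym J K) (l \<circ> k) u = app J l (app K k u)"
proof (rule nth_equalityI)
  fix i assume "i < length (app (comp_sym J K) (l \<circ> k) u)"
  then show "app (comp_sym J K) (l \<circ> k) u ! i = app J l (app K k u) ! i"
    using valid_sym[OF J, of i "k (length u)"] by (auto simp: nth_app comp_sym_def)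
qed simp

text \<open>Once \<open>s\<close> and \<open>p\<close> are fixed, copies of their letters become
  constants of \<open>insert p C\<close>, so the rest \<open>w\<close> again undergoes a
  substitution, the same for all \<open>w\<close>.\<close>

lemma app_Cons_split:
  assumes v: "valid C J l" and s: "s \<in> lists C"
  obtains J' l' where "valid (insert p C) J' l'"
    "\<And>w. app J l (s @ p # w) = app J l s @ p # app J' l' w"
proof -
  define n where "n = length s"
  \<comment> \<open>The \<open>n + 1\<close> letters of \<open>s\<close> and \<open>p\<close> drop
    out of the numbering, and so do the first \<open>l n + 1\<close> positions, the last of which
    holds \<open>p\<close>.\<close>
  define J' where "J' i = (case J (Suc (l n) + i) of Con c \<Rightarrow> Con c
      | Ref j \<Rightarrow> if j < n then Con (s ! j) else if j = n then Con p else Ref (j - Suc n))" for i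
  define l' where "l' m = l (Suc n + m) - Suc (l n)" for m
  have sm: "strict_mono l" using v by (simp add: valid_def)
  have less: "l n < l (Suc n + m)" for m using sm by (simp add: strict_mono_less)
  have l': "Suc (l n) + l' m = l (Suc n + m)" for m using less[of m] by (simp add: l'_def)
  have "valid (insert p C) J' l'" unfolding valid_def
  proof (intro conjI allI impI)
    show "strict_mono l'"
    proof (rule strict_monoI)
      fix x y :: nat assume "x < y"
      then have "l (Suc n + x) < l (Suc n + y)" using sm by (simp add: strict_mono_less)
      then show "l' x < l' y" using l'[of x] l'[of y] by linarith
    qed
    show "J' i \<in> Con ` insert p C \<union> Ref ` {..<m}" if "i < l' m" for i m
      using valid_sym[OF v, of "Suc (l n) + i" "Suc n + m"] that l'[of m] s
      by (auto simp: J'_def n_def)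
    show "J' (l' m) = Ref m" for m
      using valid_Ref[OF v, of "Suc n + m"] l'[of m] by (simp add: J'_def)
  qed
  moreover have "app J l (s @ p # w) = app J l s @ p # app J' l' w" for w
  proof (rule nth_equalityI)
    show "length (app J l (s @ p # w)) = length (app J l s @ p # app J' l' w)"
      using l'[of "length w"] by (simp add: n_def)
    fix i assume "i < length (app J l (s @ p # w))"
    then have i: "i < l (Suc n + length w)" by (simp add: n_def)
    consider "i < l n" | "i = l n" | k where "i = Suc (l n) + k" "k < l' (length w)"
      using i l'[of "length w"] by (metis add_diff_inverse_nat nat_add_left_cancel_less not_less_eq not_less_iff_gr_or_eq)
    then show "app J l (s @ p # w) ! i = (app J l s @ p # app J' l' w) ! i"
    proof cases
      case 1
      then show ?thesis using valid_sym[OF v 1] i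
        by (auto simp: nth_app nth_append n_def)
    next
      case 2
      then show ?thesis using valid_Ref[OF v, of n] i
        by (auto simp: nth_app nth_append n_def)
    next
      case (3 k)
      have "J i \<in> Con ` C \<union> Ref ` {..<Suc n + length w}" using valid_sym[OF v i] .
      then show ?thesis using 3 i
        by (auto simp: nth_app nth_append n_def J'_def nth_Cons' not_less)
    qed
  qed
  ultimately show ?thesis using that by blast
qed

lemma app_lists:
  assumes "valid C J l" "u \<in> lists C"
  shows "app J l u \<in> lists C"
proof -
  have "eval_sym u (J i) \<in> C" if "i < l (length u)" for i
    using valid_sym[OF assms(1) that] assms(2) by auto
  then show ?thesis by (auto simp: app_def)
qed

lemma app_pwords: "valid C J l \<Longrightarrow> u \<in> pwords C ps \<Longrightarrow> app J l u \<in> pwords C ps"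
proof (induction ps arbitrary: C J l u)
  case Nil then show ?case using app_lists[of C J l u] by simp
next
  case (Cons p ps)
  then obtain s w where u: "u = s @ p # w" "s \<in> lists C" "w \<in> pwords (insert p C) ps" by auto
  obtain J' l' where "valid (insert p C) J' l'"
    "app J l (s @ p # w) = app J l s @ p # app J' l' w"
    using app_Cons_split[OF Cons.prems(1) u(2)] by metis
  then have "app J l u = app J l s @ p # app J' l' w" "app J' l' w \<in> pwords (insert p C) ps"
    using Cons.IH u by auto
  then show ?case using app_lists[OF Cons.prems(1) u(2)] unfolding pwords.simps by blast
qed

text \<open>The colourings are treated in turn and the substitutions composed. Colourings already
  made constant remain so because substitutions map \<open>pwords C ps\<close> into itself.\<close>

lemma canonizable_finite:
  assumes "canonizable C ps" "finite K"
  shows "\<exists>J l. valid C J l \<and> (\<forall>color\<in>K. \<exists>c::bool. \<forall>u\<in>pwords C ps. color (app J l u) = c)"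
  using assms(2)
proof induction
  case empty then show ?case using valid_id by blast
next
  case (insert color K)
  then obtain J l where J: "valid C J l" "\<And>color. color \<in> K \<Longrightarrow> \<exists>c. \<forall>u\<in>pwords C ps. color (app J l u) = c"
    by blast
  obtain J' l' c where J': "valid C J' l'" "\<forall>u\<in>pwords C ps. color (app J l (app J' l' u)) = c"
    using assms(1)[unfolded canonizable_def, rule_format, of "\<lambda>u. color (app J l u)"] by auto
  have "\<exists>c. \<forall>u\<in>pwords C ps. col' (app (comp_sym J J') (l \<circ> l') u) = c"
    if col': "col' \<in> insert color K" for col'
  proof (cases "col' = color")
    case True
    then show ?thesis using J'(2) by (auto simp: app_comp[OF J(1)])
  next
    case False
    then obtain c where "\<forall>u\<in>pwords C ps. col' (app J l u) = c" using J(2) col' by blast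
    then have "\<forall>u\<in>pwords C ps. col' (app J l (app J' l' u)) = c" using app_pwords[OF J'(1)] by simp
    then show ?thesis by (auto simp: app_comp[OF J(1)])
  qed
  then show ?case using valid_comp[OF J(1) J'(1)] by blast
qed

text \<open>Instead of being inserted as a constant, \<open>p\<close> can be copied from position
  \<open>n\<close> of \<open>s @ p # w\<close>. So a substitution for \<open>w\<close> over
  \<open>insert p C\<close> becomes one for the whole word over \<open>C\<close>.\<close>

lemma valid_lift:
  assumes v: "valid (insert p C) J l" and p: "p \<notin> C"
  obtains J' l' where "valid C J' l'" "\<And>m. m \<le> n \<Longrightarrow> l' m = m" "\<And>i. i \<le> n \<Longrightarrow> J' i = Ref i"
    "\<And>s w. length s = n \<Longrightarrow> app J' l' (s @ p # w) = s @ p # app J l w"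
proof -
  define J' where "J' i = (if i \<le> n then Ref i else (case J (i - Suc n) of
      Con c \<Rightarrow> if c = p then Ref n else Con c | Ref j \<Rightarrow> Ref (Suc n + j)))" for i
  define l' where "l' m = (if m \<le> n then m else Suc n + l (m - Suc n))" for m
  have sm: "strict_mono l" using v by (simp add: valid_def)
  have "valid C J' l'" unfolding valid_def
  proof (intro conjI allI impI)
    show "strict_mono l'"
      by (rule strict_monoI) (use sm in \<open>auto simp: l'_def strict_mono_less\<close>)
    show "J' i \<in> Con ` C \<union> Ref ` {..<m}" if "i < l' m" for i m
    proof (cases "m \<le> n \<or> i \<le> n")
      case True then show ?thesis using that by (auto simp: J'_def l'_def split: if_splits)
    next
      case False
      then have "J (i - Suc n) \<in> Con ` insert p C \<union> Ref ` {..<m - Suc n}"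
        using that by (intro valid_sym[OF v]) (auto simp: l'_def)
      then show ?thesis using False by (auto simp: J'_def)
    qed
    show "J' (l' m) = Ref m" for m
      using valid_Ref[OF v, of "m - Suc n"] by (auto simp: J'_def l'_def)
  qed
  moreover have "app J' l' (s @ p # w) = s @ p # app J l w" if s: "length s = n" for s w
  proof (rule nth_equalityI)
    show len: "length (app J' l' (s @ p # w)) = length (s @ p # app J l w)"
      using s by (simp add: l'_def)
    fix i assume i: "i < length (app J' l' (s @ p # w))"
    show "app J' l' (s @ p # w) ! i = (s @ p # app J l w) ! i"
    proof (cases "i \<le> n")
      case True
      then show ?thesis using i s by (auto simp: nth_app J'_def nth_append)
    next
      case False
      then obtain k where k: "i = Suc n + k" using le_Suc_ex[of "Suc n" i] by auto
      have "l' (length (s @ p # w)) = Suc n + l (length w)" using s by (simp add: l'_def)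
      then have kl: "k < l (length w)" using i unfolding length_app k by linarith
      have "app J' l' (s @ p # w) ! i = eval_sym (s @ p # w) (J' i)" using i by (simp add: nth_app)
      also have "\<dots> = eval_sym w (J k)"
        using valid_sym[OF v kl] s unfolding k by (auto simp: J'_def nth_append)
      also have "\<dots> = (s @ p # app J l w) ! i" using kl s unfolding k by (simp add: nth_app nth_append)
      finally show ?thesis .
    qed
  qed
  moreover have "l' m = m" if "m \<le> n" for m using that by (simp add: l'_def)
  moreover have "J' i = Ref i" if "i \<le> n" for i using that by (simp add: J'_def)
  ultimately show ?thesis using that by blast
qed

lemma valid_ge: "valid C J l \<Longrightarrow> n \<le> l n"
  by (simp add: valid_def strict_mono_imp_increasing)

lemma app_eq_self:
  assumes "\<And>m. m \<le> n \<Longrightarrow> k m = m" "\<And>i. i \<le> n \<Longrightarrow> K i = Ref i" "length u \<le> n"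
  shows "app K k u = u"
  using assms by (intro nth_equalityI) (auto simp: nth_app)

lemma canonizable_Cons:
  fixes C :: "'a set"
  assumes "finite C" "p \<notin> C" and C: "canonizable C []" and ps: "canonizable (insert p C) ps"
  shows "canonizable C (p # ps)"
  unfolding canonizable_def
proof
  fix color :: "'a list \<Rightarrow> bool"
  let ?W = "pwords (insert p C) ps"
  \<comment> \<open>Fusion: step \<open>n\<close> leaves the first \<open>n + 1\<close> positions unchanged and makes the colour of \<open>s @ p # w\<close>
    independent of \<open>w\<close> whenever \<open>length s = n\<close>. In the limit the colour depends on \<open>s\<close> only.\<close>
  define step where "step n J l K k \<longleftrightarrow> valid C K k \<and> (\<forall>m\<le>n. k m = m) \<and> (\<forall>i\<le>n. K i = Ref i) \<and>
      (\<forall>s\<in>lists C. length s = n \<longrightarrow> (\<exists>c. \<forall>w\<in>?W. color (app J l (app K k (s @ p # w))) = c))" for n J l K k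
  have ex_step: "\<exists>K k. step n J l K k" for n J l
  proof -
    \<comment> \<open>Each prefix \<open>s\<close> of length \<open>n\<close> gives a colouring of
      the continuations \<open>w\<close>. There are finitely many, so one substitution handles them
      all.\<close>
    define \<K> where "\<K> = (\<lambda>s w. color (app J l (s @ p # w))) ` {s. set s \<subseteq> C \<and> length s = n}"
    have "finite \<K>" using assms(1) by (simp add: \<K>_def finite_lists_length_eq)
    from canonizable_finite[OF ps this] obtain K0 k0 where K0: "valid (insert p C) K0 k0"
      "\<forall>f\<in>\<K>. \<exists>c. \<forall>w\<in>?W. f (app K0 k0 w) = c" by (elim exE conjE)
    obtain K k where K: "valid C K k" "\<And>m. m \<le> n \<Longrightarrow> k m = m" "\<And>i. i \<le> n \<Longrightarrow> K i = Ref i"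
      "\<And>s w. length s = n \<Longrightarrow> app K k (s @ p # w) = s @ p # app K0 k0 w"
      using valid_lift[OF K0(1) assms(2), of n] by blast
    have "\<exists>c. \<forall>w\<in>?W. color (app J l (app K k (s @ p # w))) = c" if "s \<in> lists C" "length s = n" for s
    proof -
      have "(\<lambda>w. color (app J l (s @ p # w))) \<in> \<K>" using that by (auto simp: \<K>_def)
      from bspec[OF K0(2) this] show ?thesis by (simp add: K(4)[OF that(2)])
    qed
    then have "step n J l K k" using K(1-3) by (simp add: step_def)
    then show ?thesis by blast
  qed
  have "\<exists>F. \<forall>n. valid C (fst (F n)) (snd (F n)) \<and>
      (\<exists>K k. step n (fst (F n)) (snd (F n)) K k \<and> F (Suc n) = (comp_sym (fst (F n)) K, snd (F n) \<circ> k))"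
  proof (rule dependent_nat_choice, goal_cases)
    case 1 show ?case using valid_id by (intro exI[of _ "(Ref, \<lambda>n. n)"]) simp
  next
    case (2 F n)
    obtain K k where st: "step n (fst F) (snd F) K k" using ex_step by blast
    then have "valid C K k" by (simp add: step_def)
    then have "valid C (comp_sym (fst F) K) (snd F \<circ> k)" by (rule valid_comp[OF 2])
    with st show ?case by (intro exI[of _ "(comp_sym (fst F) K, snd F \<circ> k)"] conjI exI) (simp_all add: comp_def)
  qed
  then obtain F where F: "\<And>n. valid C (fst (F n)) (snd (F n))"
    and "\<And>n. \<exists>K k. step n (fst (F n)) (snd (F n)) K k \<and> F (Suc n) = (comp_sym (fst (F n)) K, snd (F n) \<circ> k)"
    by blast
  then obtain K k where Kk: "\<And>n. step n (fst (F n)) (snd (F n)) (K n) (k n)"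
    and FSuc: "\<And>n. F (Suc n) = (comp_sym (fst (F n)) (K n), snd (F n) \<circ> k n)" by metis
  define J where "J n = fst (F n)" for n
  define l where "l n = snd (F n)" for n
  have v: "valid C (J n) (l n)" for n using F by (simp add: J_def l_def)
  have JSuc: "J (Suc n) = comp_sym (J n) (K n)" and lSuc: "l (Suc n) = l n \<circ> k n" for n
    using FSuc by (simp_all add: J_def l_def)
  have K: "valid C (K n) (k n)" and k_id: "m \<le> n \<Longrightarrow> k n m = m" and K_id: "i \<le> n \<Longrightarrow> K n i = Ref i" for m n i
    using Kk[of n] by (auto simp: step_def)
  have Kc: "\<exists>c. \<forall>w\<in>?W. color (app (J (Suc n)) (l (Suc n)) (s @ p # w)) = c"
    if "s \<in> lists C" "length s = n" for s n
    using Kk[of n] that unfolding step_def JSuc lSuc app_comp[OF v] by (simp add: J_def l_def)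
  have l_stable: "l n m = l m m" if "m \<le> n" for m n
    using that by (induction n rule: dec_induct) (simp_all add: lSuc k_id)
  \<comment> \<open>Below position \<open>l n (Suc n)\<close> only letters with index at most
    \<open>n\<close> are referenced, and every later \<open>K m\<close> fixes these. Hence the
    diagonal is the limit.\<close>
  have J_stable: "J m i = J n i" if "n \<le> m" "i < l n (Suc n)" for m n i
    using that(1)
  proof (induction m rule: dec_induct)
    case (step m)
    then show ?case using valid_sym[OF v that(2)] K_id by (auto simp: JSuc comp_sym_def)
  qed simp
  define Js where "Js i = J i i" for i
  define ls where "ls m = l m m" for m
  have Js: "Js i = J n i" if "i < l n (Suc n)" for i n
  proof (cases "n \<le> i")
    case True then show ?thesis using J_stable that by (simp add: Js_def)
  next
    case False
    have "i < l i (Suc i)" using valid_ge[OF v, of "Suc i" i] by simp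
    then show ?thesis using J_stable[of i n i] False by (simp add: Js_def)
  qed
  have l_Suc_less: "l n n < l n (Suc n)" for n using valid_less[OF v] by blast
  have vs: "valid C Js ls" unfolding valid_def
  proof (intro conjI allI impI)
    show "strict_mono ls"
    proof (rule strict_monoI)
      fix x y :: nat assume "x < y"
      then show "ls x < ls y" using l_stable[of x y] valid_less[OF v, of y x y] by (simp add: ls_def)
    qed
    show "Js i \<in> Con ` C \<union> Ref ` {..<n}" if "i < ls n" for i n
      using valid_sym[OF v, of i n n] that Js[of i n] l_Suc_less[of n] by (simp add: ls_def)
    show "Js (ls n) = Ref n" for n
      using valid_Ref[OF v, of n n] Js[of "ls n" n] l_Suc_less[of n] by (simp add: ls_def)
  qed
  have app_s: "app Js ls u = app (J n) (l n) u" if "length u \<le> n" for u n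
  proof (rule nth_equalityI)
    show len: "length (app Js ls u) = length (app (J n) (l n) u)"
      using l_stable[OF that] by (simp add: ls_def)
    fix i assume i: "i < length (app Js ls u)"
    then have "i < l (length u) (Suc (length u))" using l_Suc_less[of "length u"] by (simp add: ls_def)
    then have "Js i = J n i" using Js J_stable[OF that] by metis
    then show "app Js ls u ! i = app (J n) (l n) u ! i" using i len by (simp add: nth_app)
  qed
  have "\<exists>c. \<forall>w\<in>?W. color (app Js ls (s @ p # w)) = c" if s: "s \<in> lists C" for s
  proof -
    define n where "n = length s"
    from Kc[OF s n_def[symmetric]] obtain c
      where c: "\<forall>w\<in>?W. color (app (J (Suc n)) (l (Suc n)) (s @ p # w)) = c" ..
    \<comment> \<open>Later steps leave \<open>s\<close> and \<open>p\<close> in place and move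
      \<open>w\<close> only inside \<open>?W\<close>, so the constant colour is kept.\<close>
    have "\<forall>w\<in>?W. color (app (J m) (l m) (s @ p # w)) = c" if "Suc n \<le> m" for m
      using that
    proof (induction m rule: dec_induct)
      case base then show ?case using c .
    next
      case (step m)
      show ?case
      proof
        fix w assume w: "w \<in> ?W"
        obtain K' k' where K': "valid (insert p C) K' k'"
          "\<And>w. app (K m) (k m) (s @ p # w) = app (K m) (k m) s @ p # app K' k' w"
          by (rule app_Cons_split[where p = p, OF K[of m] s]) (rule that)
        have "app (K m) (k m) s = s"
          using step(1) by (intro app_eq_self[of m]) (auto simp: k_id K_id n_def)
        then show "color (app (J (Suc m)) (l (Suc m)) (s @ p # w)) = c"
          using bspec[OF step.IH app_pwords[OF K'(1) w]] by (simp add: JSuc lSuc app_comp[OF v] K'(2))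
      qed
    qed
    then have "color (app Js ls (s @ p # w)) = c" if "w \<in> ?W" for w
      using that app_s[of "s @ p # w" "Suc n + length w"] by (simp add: n_def)
    then show ?thesis by blast
  qed
  then have "\<forall>s\<in>lists C. \<exists>c. \<forall>w\<in>?W. color (app Js ls (s @ p # w)) = c" by (intro ballI)
  from bchoice[OF this] obtain c' where
    c': "\<forall>s\<in>lists C. \<forall>w\<in>?W. color (app Js ls (s @ p # w)) = c' s" ..
  from C[unfolded canonizable_def, rule_format, of c'] obtain L g c
    where L: "valid C L g" "\<forall>s\<in>lists C. c' (app L g s) = c" by auto
  have "color (app (comp_sym Js L) (ls \<circ> g) u) = c" if "u \<in> pwords C (p # ps)" for u
  proof -
    obtain s w where u: "u = s @ p # w" "s \<in> lists C" "w \<in> ?W" using \<open>u \<in> pwords C (p # ps)\<close> by auto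
    obtain L' g' where L': "valid (insert p C) L' g'"
      "\<And>w. app L g (s @ p # w) = app L g s @ p # app L' g' w"
      by (rule app_Cons_split[where p = p, OF L(1) u(2)]) (rule that)
    show ?thesis
      using bspec[OF bspec[OF c' app_lists[OF L(1) u(2)]] app_pwords[OF L'(1) u(3)]] bspec[OF L(2) u(2)]
      by (simp add: app_comp[OF vs] u(1) L'(2))
  qed
  then show "\<exists>J l c. valid C J l \<and> (\<forall>u\<in>pwords C (p # ps). color (app J l u) = c)"
    using valid_comp[OF vs L(1)] by (intro exI conjI ballI)
qed

text \<open>Concatenate \<open>s0\<close> and the words \<open>Y i\<close>, reading the variable of
  \<open>Y i\<close> as letter \<open>i\<close>. As \<open>Y n\<close> begins with the variable,
  position \<open>l n\<close> is the first to hold letter \<open>n\<close>.\<close>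

lemma canonizable_Nil:
  assumes "finite C" "C \<noteq> {}"
  shows "canonizable C []"
  unfolding canonizable_def
proof
  fix color :: "'a list \<Rightarrow> bool"
  obtain s0 Y c where s0: "s0 \<in> lists C" and Y: "\<And>n. Y n \<in> lvar C"
    and c: "\<And>u. u \<in> lists C \<Longrightarrow> color (s0 @ concat (map (\<lambda>i. subst (u ! i) (Y i)) [0..<length u])) = c"
    by (rule infinite_Hales_Jewett[OF assms, of color]) (rule that)
  define tr :: "nat \<Rightarrow> 'a option \<Rightarrow> 'a sym" where "tr i = case_option (Ref i) Con" for i
  define blocks where "blocks n = map Con s0 @ concat (map (\<lambda>i. map (tr i) (Y i)) [0..<n])" for n
  define l where "l n = length (blocks n)" for n
  \<comment> \<open>All \<open>Y i\<close> are nonempty, so \<open>blocks (Suc i)\<close> already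
    has a position \<open>i\<close>, and longer block sequences agree with it there.\<close>
  define J where "J i = blocks (Suc i) ! i" for i
  have Y0: "Y n \<noteq> []" "hd (Y n) = None" "set (Y n) \<subseteq> insert None (Some ` C)" for n
    using Y[of n] by (auto simp: lvar_def)
  have bSuc: "blocks (Suc n) = blocks n @ map (tr n) (Y n)" for n by (simp add: blocks_def)
  have l_less: "l n < l (Suc n)" for n using Y0(1)[of n] by (simp add: l_def bSuc)
  then have sm: "strict_mono l" by (simp add: strict_mono_Suc_iff)
  have prefix: "\<exists>r. blocks m = blocks n @ r" if "n \<le> m" for n m
    using that by (induction m rule: dec_induct) (auto simp: bSuc)
  have J: "J i = blocks n ! i" if "i < l n" for i n
  proof -
    have i: "i < l (Suc i)" using strict_mono_imp_increasing[OF sm, of "Suc i"] by simp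
    show ?thesis
    proof (cases "n \<le> Suc i")
      case True
      then show ?thesis using prefix[OF True] that by (auto simp: J_def l_def nth_append)
    next
      case False
      then show ?thesis using prefix[of "Suc i" n] i by (auto simp: J_def l_def nth_append)
    qed
  qed
  have "valid C J l" unfolding valid_def
  proof (intro conjI allI impI sm)
    have sub: "set (blocks n) \<subseteq> Con ` C \<union> Ref ` {..<n}" for n
    proof (induction n)
      case 0 then show ?case using s0 by (auto simp: blocks_def)
    next
      case (Suc n)
      have "tr n x \<in> Con ` C \<union> Ref ` {..<Suc n}" if "x \<in> set (Y n)" for x
        using Y0(3)[of n] that by (auto simp: tr_def)
      then show ?case using Suc by (auto simp: bSuc)
    qed
    show "J i \<in> Con ` C \<union> Ref ` {..<n}" if "i < l n" for i n
      using subsetD[OF sub[of n] nth_mem[of i "blocks n"]] that J[OF that] by (simp add: l_def)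
    show "J (l n) = Ref n" for n
    proof -
      have "J (l n) = tr n (hd (Y n))"
        using J[OF l_less[of n]] Y0(1)[of n] by (simp add: bSuc l_def nth_append hd_conv_nth)
      then show ?thesis by (simp add: Y0(2) tr_def)
    qed
  qed
  moreover have "color (app J l u) = c" if u: "u \<in> lists C" for u
  proof -
    have "app J l u = map (eval_sym u) (blocks (length u))"
      by (rule nth_equalityI) (auto simp: nth_app J, auto simp: l_def)
    also have "\<dots> = s0 @ concat (map (\<lambda>i. map (\<lambda>x. eval_sym u (tr i x)) (Y i)) [0..<length u])"
      by (simp add: blocks_def map_concat comp_def)
    also have "\<dots> = s0 @ concat (map (\<lambda>i. subst (u ! i) (Y i)) [0..<length u])"
      by (intro arg_cong[where f = "\<lambda>x. s0 @ concat x"] map_cong)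
        (auto simp: subst_def tr_def split: option.splits)
    finally show ?thesis using c[OF u] by simp
  qed
  ultimately show "\<exists>J l c. valid C J l \<and> (\<forall>u\<in>pwords C []. color (app J l u) = c)"
    unfolding pwords.simps by (intro exI conjI ballI)
qed

theorem canonizable:
  assumes "finite C" "C \<noteq> {}" "distinct ps" "set ps \<inter> C = {}"
  shows "canonizable C ps"
  using assms
proof (induction ps arbitrary: C)
  case Nil then show ?case by (simp add: canonizable_Nil)
next
  case (Cons p ps)
  then show ?case by (intro canonizable_Cons canonizable_Nil) auto
qed

text \<open>No letter of \<open>ps\<close> precedes the first occurrence of its largest letter
  \<open>p\<close>. So the part before it lies in \<open>lists C\<close>, and the last hypothesis
  passes to the part after it.\<close>

lemma pwordsI:
  fixes ps :: "'a::linorder list"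
  assumes "set w \<subseteq> C \<union> set ps" "set ps \<subseteq> set w" "sorted_wrt (>) ps" "set ps \<inter> C = {}"
    "\<And>i q. i < length w \<Longrightarrow> q \<in> set ps \<Longrightarrow> w ! i < q \<Longrightarrow> w ! i \<in> set ps \<Longrightarrow> q \<in> set (take i w)"
  shows "w \<in> pwords C ps"
  using assms
proof (induction ps arbitrary: C w)
  case Nil then show ?case by auto
next
  case (Cons p ps)
  have "p \<in> set w" using Cons.prems(2) by simp
  then obtain s v where w: "w = s @ p # v" "p \<notin> set s" by (metis split_list_first)
  have big: "q < p" if "q \<in> set ps" for q using Cons.prems(3) that by simp
  have s: "set s \<inter> set ps = {}"
  proof (rule ccontr)
    assume "set s \<inter> set ps \<noteq> {}"
    then obtain x where "x \<in> set s" "x \<in> set ps" by blast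
    then obtain i where i: "i < length s" "s ! i \<in> set ps" by (metis in_set_conv_nth)
    then have "p \<in> set (take i w)"
      using Cons.prems(5)[of i p] big w(1) by (auto simp: nth_append)
    then show False using w i by (auto dest: in_set_takeD)
  qed
  then have "s \<in> lists C" using Cons.prems(1) w by auto
  moreover have "v \<in> pwords (insert p C) ps"
  proof (rule Cons.IH)
    show "set v \<subseteq> insert p C \<union> set ps" using Cons.prems(1) w by auto
    show "set ps \<subseteq> set v" using Cons.prems(2) w(1) s big by auto
    show "sorted_wrt (>) ps" using Cons.prems(3) by simp
    show "set ps \<inter> insert p C = {}" using Cons.prems(4) big by auto
    fix i q assume i: "i < length v" "q \<in> set ps" "v ! i < q" "v ! i \<in> set ps"
    then have "q \<in> set (take (Suc (length s + i)) w)"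
      using Cons.prems(5)[of "Suc (length s + i)" q] w(1) by (auto simp: nth_append)
    then show "q \<in> set (take i v)" using w(1) s i(2) big by auto
  qed
  ultimately show ?case using w(1) by auto
qed

lemma div_mod_block:
  fixes k m n :: nat
  assumes "m < k"
  shows "(n * k + m) div k = n" "(n * k + m) mod k = m"
  using assms by simp_all

section \<open>Distances in a Urysohn space\<close>

locale urysohn =
  fixes D :: "real set" and M :: "'a set" and d :: "'a \<Rightarrow> 'a \<Rightarrow> real"
  assumes finite_D: "finite D" and zero_D: "0 \<in> D" and D_nonneg: "r \<in> D \<Longrightarrow> 0 \<le> r"
    and space: "urysohn_space D M d"
begin

section \<open>Basic distances and one-point extensions\<close>

lemma metric: "metric_on M d"
  using space by (simp add: urysohn_space_def)

lemma d_nonneg: "x \<in> M \<Longrightarrow> y \<in> M \<Longrightarrow> 0 \<le> d x y"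
  and d_eq_0: "x \<in> M \<Longrightarrow> y \<in> M \<Longrightarrow> d x y = 0 \<longleftrightarrow> x = y"
  and d_sym: "x \<in> M \<Longrightarrow> y \<in> M \<Longrightarrow> d x y = d y x"
  and d_triangle: "x \<in> M \<Longrightarrow> y \<in> M \<Longrightarrow> z \<in> M \<Longrightarrow> d x z \<le> d x y + d y z"
  using metric unfolding metric_on_def by blast+

lemma d_self [simp]: "x \<in> M \<Longrightarrow> d x x = 0"
  using d_eq_0 by blast

lemma d_in_D: "x \<in> M \<Longrightarrow> y \<in> M \<Longrightarrow> d x y \<in> D"
  using space by (auto simp: urysohn_space_def dist_set_def)

lemma isometry_extends:
  assumes "F \<subseteq> M" "G \<subseteq> M" "finite F" "finite G" "isometry_onto F d G d g"
  shows "\<exists>h. isometry_onto M d M d h \<and> (\<forall>x\<in>F. h x = g x)"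
  using space assms by (simp add: urysohn_space_def homogeneous_def)

lemma M_nonempty: "M \<noteq> {}"
  using space zero_D by (auto simp: urysohn_space_def dist_set_def)

text \<open>Katetov functions: the possible distances from one point to \<open>F\<close>. The value
  \<open>0\<close> is allowed and means a point of \<open>F\<close>.\<close>

definition katetov :: "'a set \<Rightarrow> ('a \<Rightarrow> real) \<Rightarrow> bool" where
  "katetov F k \<longleftrightarrow> (\<forall>x\<in>F. k x \<in> D) \<and> (\<forall>x\<in>F. \<forall>y\<in>F. k x \<le> k y + d x y \<and> d x y \<le> k x + k y)"

text \<open>If \<open>k x0 = 0\<close>, then \<open>x0\<close> serves. Otherwise the extension of
  \<open>F\<close> by a new point, numbered \<open>n\<close>, embeds into \<open>M\<close>, and
  homogeneity moves the image of \<open>F\<close> back onto \<open>F\<close>, taking the new point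
  along.\<close>

lemma katetov_realized:
  assumes F: "finite F" "F \<subseteq> M" and k: "katetov F k"
  shows "\<exists>y\<in>M. \<forall>x\<in>F. d y x = k x"
proof (cases "\<exists>x0\<in>F. k x0 = 0")
  case True
  then obtain x0 where x0: "x0 \<in> F" "k x0 = 0" by blast
  have "d x0 x = k x" if "x \<in> F" for x
    using k x0 that F d_sym[of x x0] unfolding katetov_def by (smt (verit) subsetD)
  then show ?thesis using x0 F by blast
next
  case False
  have kD: "k x \<in> D" "0 < k x" if "x \<in> F" for x
    using k False that D_nonneg[of "k x"] by (auto simp: katetov_def less_le)
  have kk: "k x \<le> k y + d x y" "d x y \<le> k x + k y" if "x \<in> F" "y \<in> F" for x y
    using k that by (auto simp: katetov_def)
  have M: "x \<in> M" if "x \<in> F" for x using F that by blast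
  obtain h n where h: "bij_betw h F {0..<n::nat}" using ex_bij_betw_finite_nat[OF F(1)] by blast
  define g where "g = inv_into F h"
  have g: "g i \<in> F" if "i < n" for i
    using that h by (metis atLeastLessThan_iff bij_betw_def g_def inv_into_into zero_le)
  have g_inj: "g i = g j \<longleftrightarrow> i = j" if "i < n" "j < n" for i j
    using that h unfolding g_def
    by (metis atLeastLessThan_iff bij_betw_inv_into_right zero_le)
  have gh: "g (h x) = x" if "x \<in> F" for x
    using that h by (simp add: g_def bij_betw_inv_into_left)
  have hn: "h x < n" if "x \<in> F" for x using that h by (auto simp: bij_betw_def)
  define dF where "dF i j = (if i = j then 0 else if i = n then k (g j) else if j = n then k (g i)
      else d (g i) (g j))" for i j
  have "metric_on {..n} dF" unfolding metric_on_def
  proof (intro conjI ballI)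
    fix x y assume xy: "x \<in> {..n}" "y \<in> {..n}"
    then have xn: "x \<noteq> n \<Longrightarrow> x < n" and yn: "y \<noteq> n \<Longrightarrow> y < n" by auto
    show "0 \<le> dF x y" using xn yn g kD d_nonneg M by (auto simp: dF_def intro: less_imp_le)
    show "dF x y = 0 \<longleftrightarrow> x = y"
      using xn yn g kD(2) d_eq_0 M g_inj by (force simp: dF_def)
    show "dF x y = dF y x" using xn yn g d_sym M by (auto simp: dF_def)
    fix z assume z: "z \<in> {..n}"
    then have zn: "z \<noteq> n \<Longrightarrow> z < n" by auto
    show "dF x z \<le> dF x y + dF y z"
    proof (cases "x = z \<or> x = y \<or> y = z")
      case True
      then show ?thesis using \<open>0 \<le> dF x y\<close> \<open>dF x y = dF y x\<close> by (auto simp: dF_def)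
    next
      case False
      consider "x = n" "y < n" "z < n" | "y = n" "x < n" "z < n" | "z = n" "x < n" "y < n"
        | "x < n" "y < n" "z < n" using False xn yn zn by metis
      then show ?thesis
      proof cases
        case 1
        then show ?thesis using False kk(1)[OF g g, of z y] d_sym[OF M M, OF g g, of z y] by (simp add: dF_def)
      next
        case 2
        then show ?thesis using False kk(2)[OF g g, of x z] by (simp add: dF_def)
      next
        case 3
        then show ?thesis using False kk(1)[OF g g, of x y] by (simp add: dF_def)
      next
        case 4
        then show ?thesis using False d_triangle[OF M M M, OF g g g, of x y z] by (simp add: dF_def)
      qed
    qed
  qed
  moreover have "dF i j \<in> D" if "i \<le> n" "j \<le> n" for i j
    using g[of i] g[of j] kD(1) d_in_D M zero_D that by (simp add: dF_def)
  then have "dist_set {..n} dF \<subseteq> D" by (auto simp: dist_set_def)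
  ultimately obtain f where f: "isometric_embedding {..n} dF M d f"
    using space finite_atMost[of n] unfolding urysohn_space_def by metis
  have fM: "f i \<in> M" and fd: "d (f i) (f j) = dF i j" if "i \<le> n" "j \<le> n" for i j
    using f that by (auto simp: isometric_embedding_def)
  have fh: "d (f (h x)) (f (h y)) = d x y" if "x \<in> F" "y \<in> F" for x y
  proof -
    have "h x = h y \<longleftrightarrow> x = y" using gh that by metis
    then show ?thesis using fd[of "h x" "h y"] hn[OF that(1)] hn[OF that(2)] gh that M by (simp add: dF_def)
  qed
  have inj: "inj_on (f \<circ> h) F"
  proof (rule inj_onI)
    fix x y assume xy: "x \<in> F" "y \<in> F" "(f \<circ> h) x = (f \<circ> h) y"
    then have "d x y = 0" using fh[of x y] d_eq_0 fM[of "h x" n] hn[of x] by simp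
    then show "x = y" using d_eq_0 M xy by blast
  qed
  define q where "q = inv_into F (f \<circ> h)"
  have q: "q (f (h x)) = x" if "x \<in> F" for x
    using inv_into_f_f[OF inj that] by (simp add: q_def)
  have "isometry_onto ((f \<circ> h) ` F) d F d q"
    unfolding isometry_onto_def
  proof (intro conjI ballI)
    show "bij_betw q ((f \<circ> h) ` F) F"
      unfolding q_def by (rule bij_betw_inv_into[OF inj_on_imp_bij_betw[OF inj]])
  qed (auto simp: q fh)
  moreover have "(f \<circ> h) ` F \<subseteq> M" using fM hn by (auto intro: less_imp_le)
  ultimately obtain H where H: "isometry_onto M d M d H" "\<forall>x\<in>(f \<circ> h) ` F. H x = q x"
    using isometry_extends[of "(f \<circ> h) ` F" F q] F by auto
  have "d (H (f n)) x = k x" if "x \<in> F" for x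
  proof -
    have "H (f (h x)) = x" using H(2) q that by auto
    then have "d (H (f n)) x = d (f n) (f (h x))"
      using H(1) fM[of n n] fM[of "h x" n] hn[OF that] unfolding isometry_onto_def by (metis less_imp_le order_refl)
    then show ?thesis using fd[of n "h x"] hn[OF that] gh that by (simp add: dF_def)
  qed
  moreover have "H (f n) \<in> M" using H(1) fM[of n n] by (auto simp: isometry_onto_def bij_betw_def)
  ultimately show ?thesis by blast
qed

definition tri :: "real \<Rightarrow> real \<Rightarrow> real \<Rightarrow> bool" where
  "tri a b c \<longleftrightarrow> a \<le> b + c \<and> b \<le> a + c \<and> c \<le> a + b"

lemma triangle_realized:
  assumes "p \<in> M" "q \<in> M" "b \<in> D" "c \<in> D" "tri (d p q) b c"
  obtains y where "y \<in> M" "d y p = b" "d y q = c"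
proof -
  have bc: "p = q \<Longrightarrow> b = c"
    using assms D_nonneg d_eq_0[of p q] by (auto simp: tri_def)
  have "katetov {p, q} (\<lambda>x. if x = p then b else c)"
    using assms d_sym[of p q] bc D_nonneg[of b] D_nonneg[of c] by (auto simp: katetov_def tri_def)
  from katetov_realized[OF _ _ this] obtain y
    where "y \<in> M" "\<forall>x\<in>{p, q}. d y x = (if x = p then b else c)" using assms(1,2) by auto
  then show ?thesis using that[of y] bc by auto
qed

section \<open>Truncated addition of distances\<close>

definition dplus :: "real \<Rightarrow> real \<Rightarrow> real" (infixl "\<oplus>" 65) where
  "a \<oplus> b = Max {c \<in> D. c \<le> a + b}"

lemma dplus:
  assumes "a \<in> D" "b \<in> D"
  shows dplus_D: "a \<oplus> b \<in> D" and dplus_le: "a \<oplus> b \<le> a + b"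
    and dplus_ge: "\<And>c. c \<in> D \<Longrightarrow> c \<le> a + b \<Longrightarrow> c \<le> a \<oplus> b"
proof -
  have "finite {c \<in> D. c \<le> a + b}" "0 \<in> {c \<in> D. c \<le> a + b}"
    using finite_D zero_D D_nonneg[OF assms(1)] D_nonneg[OF assms(2)] by auto
  then have "a \<oplus> b \<in> {c \<in> D. c \<le> a + b}" and "\<And>c. c \<in> {c \<in> D. c \<le> a + b} \<Longrightarrow> c \<le> a \<oplus> b"
    unfolding dplus_def using Max_in Max_ge by (blast, simp)
  then show "a \<oplus> b \<in> D" "a \<oplus> b \<le> a + b" "\<And>c. c \<in> D \<Longrightarrow> c \<le> a + b \<Longrightarrow> c \<le> a \<oplus> b"
    by auto
qed

lemma dplus_commute: "a \<oplus> b = b \<oplus> a"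
  by (simp add: dplus_def add.commute)

lemma dplus_ge_left: "a \<in> D \<Longrightarrow> b \<in> D \<Longrightarrow> a \<le> a \<oplus> b"
  using dplus_ge D_nonneg by simp

lemma dplus_ge_right: "a \<in> D \<Longrightarrow> b \<in> D \<Longrightarrow> b \<le> a \<oplus> b"
  using dplus_ge D_nonneg by simp

lemma dplus_0_left [simp]: "a \<in> D \<Longrightarrow> 0 \<oplus> a = a"
  using dplus_le[OF zero_D, of a] dplus_ge[OF zero_D, of a a] by simp

text \<open>Points \<open>p1\<close>, \<open>p2\<close>, \<open>p3\<close> are reached from
  \<open>p0\<close> by steps \<open>a\<close>, \<open>b\<close>, \<open>c\<close>, each time as far
  from \<open>p0\<close> as possible. The last distance is \<open>(a \<oplus> b) \<oplus> c\<close>,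
  and going through \<open>p1\<close> bounds it by \<open>a + (b \<oplus> c)\<close>.\<close>

lemma dplus_assoc_le:
  assumes "a \<in> D" "b \<in> D" "c \<in> D"
  shows "(a \<oplus> b) \<oplus> c \<le> a \<oplus> (b \<oplus> c)"
proof -
  have D: "a \<oplus> b \<in> D" "(a \<oplus> b) \<oplus> c \<in> D" "b \<oplus> c \<in> D" using assms dplus_D by auto
  obtain p0 where p0: "p0 \<in> M" using M_nonempty by blast
  have tri: "tri x y (x \<oplus> y)" "tri x (x \<oplus> y) y" if "x \<in> D" "y \<in> D" for x y
    using dplus_le[OF that] dplus_ge_left[OF that] dplus_ge_right[OF that] D_nonneg that
    unfolding tri_def by (smt (verit))+
  have "tri (d p0 p0) a a" using p0 D_nonneg assms by (simp add: tri_def)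
  then obtain p1 where p1: "p1 \<in> M" "d p1 p0 = a"
    using triangle_realized[OF p0 p0 assms(1,1)] by metis
  then have "tri (d p0 p1) (a \<oplus> b) b" using tri(2)[OF assms(1,2)] d_sym p0 by metis
  then obtain p2 where p2: "p2 \<in> M" "d p2 p0 = a \<oplus> b" "d p2 p1 = b"
    using triangle_realized[OF p0 p1(1) D(1) assms(2)] by metis
  then have "tri (d p0 p2) ((a \<oplus> b) \<oplus> c) c" using tri(2)[OF D(1) assms(3)] d_sym p0 by metis
  then obtain p3 where p3: "p3 \<in> M" "d p3 p0 = (a \<oplus> b) \<oplus> c" "d p3 p2 = c"
    using triangle_realized[OF p0 p2(1) D(2) assms(3)] by metis
  have "d p3 p1 \<le> c + b" using d_triangle[of p3 p2 p1] p1 p2 p3 by simp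
  then have "d p3 p1 \<le> b \<oplus> c" using dplus_ge[OF assms(2,3)] d_in_D p1 p3 by simp
  then have "(a \<oplus> b) \<oplus> c \<le> a + (b \<oplus> c)" using d_triangle[of p3 p1 p0] p0 p1 p3 by simp
  then show ?thesis using dplus_ge assms D by blast
qed

lemma dplus_assoc:
  assumes "a \<in> D" "b \<in> D" "c \<in> D"
  shows "(a \<oplus> b) \<oplus> c = a \<oplus> (b \<oplus> c)"
  using dplus_assoc_le[OF assms] dplus_assoc_le[OF assms(3,2,1)]
  by (metis antisym dplus_commute)

text \<open>The points are placed one by one with \<open>katetov_realized\<close>. Here
  \<open>\<delta>\<close> may vanish between different indices, as the distance of different words
  can be \<open>0\<close>.\<close>

lemma countable_space_embeds:
  fixes \<delta> :: "nat \<Rightarrow> nat \<Rightarrow> real"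
  assumes \<delta>: "\<And>i j. \<delta> i j \<in> D" "\<And>i. \<delta> i i = 0" "\<And>i j. \<delta> i j = \<delta> j i" "\<And>i j k. \<delta> i k \<le> \<delta> i j + \<delta> j k"
  obtains p where "\<And>n. p n \<in> M" "\<And>i j. d (p i) (p j) = \<delta> i j"
proof -
  have "\<exists>p. \<forall>n. p n \<in> M \<and> (\<forall>i<n. d (p n) (p i) = \<delta> n i)"
  proof (rule dependent_wellorder_choice)
    fix n and p :: "nat \<Rightarrow> 'a"
    assume p: "\<And>m. m < n \<Longrightarrow> p m \<in> M \<and> (\<forall>i<m. d (p m) (p i) = \<delta> m i)"
    have pd: "d (p i) (p j) = \<delta> i j" if "i < n" "j < n" for i j
      using p that \<delta>(2,3) d_eq_0 d_sym by (metis linorder_neqE_nat)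
    \<comment> \<open>The prescribed distance must depend on the point and not on its index. Any
      index will do, as indices of one point have \<open>\<delta>\<close>-distance
      \<open>0\<close>.\<close>
    define k where "k x = \<delta> n (SOME i. i < n \<and> p i = x)" for x
    have k: "k (p i) = \<delta> n i" if "i < n" for i
    proof -
      define j where "j = (SOME j. j < n \<and> p j = p i)"
      have "j < n \<and> p j = p i" unfolding j_def by (rule someI[of _ i]) (use that in simp)
      then have "\<delta> i j = 0" using pd[of i j] that p by simp
      then have "\<delta> n i = \<delta> n j" using \<delta>(4)[of n i j] \<delta>(4)[of n j i] \<delta>(3)[of i j] by simp
      then show ?thesis by (simp add: k_def j_def)
    qed
    have "katetov (p ` {..<n}) k"
      using \<delta>(1) \<delta>(4)[of n] \<delta>(4)[of _ _ n] \<delta>(3) by (auto simp: katetov_def k pd)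
    from katetov_realized[OF _ _ this] obtain y where "y \<in> M" "\<forall>x\<in>p ` {..<n}. d y x = k x"
      using p by auto
    then show "\<exists>r. r \<in> M \<and> (\<forall>i<n. d r (p i) = \<delta> n i)" using k by auto
  qed auto
  then obtain p where p: "\<And>n. p n \<in> M" "\<And>n i. i < n \<Longrightarrow> d (p n) (p i) = \<delta> n i" by blast
  have "d (p i) (p j) = \<delta> i j" for i j
    using p \<delta>(2,3) d_eq_0 d_sym by (metis linorder_neqE_nat)
  then show ?thesis using that p(1) by blast
qed

section \<open>A metric on words\<close>

text \<open>A path between the ends of an edge has a shortest word \<open>y\<close>, and \<open>y\<close> has the letter \<open>0\<close> at
  some position \<open>i\<close>. Along the whole path the \<open>i\<close>-th letters behave like distances to \<open>y\<close>, which is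
  why the path cannot be shorter than the edge.\<close>

definition edge0 :: "real list \<Rightarrow> real list \<Rightarrow> real \<Rightarrow> bool" where
  "edge0 u v c \<longleftrightarrow> u \<in> lists D \<and> v \<in> lists D \<and> c \<in> D \<and> length u < length v \<and>
     (\<exists>i<length u. u ! i = 0) \<and> (\<forall>i<length u. tri (u ! i) (v ! i) c)"

definition edge :: "real list \<Rightarrow> real list \<Rightarrow> real \<Rightarrow> bool" where
  "edge u v c \<longleftrightarrow> edge0 u v c \<or> edge0 v u c"

text \<open>\<open>reach m u v a\<close>: some path from \<open>u\<close> to \<open>v\<close> through words of length at least \<open>m\<close> has length
  \<open>a\<close>.\<close>

inductive reach :: "nat \<Rightarrow> real list \<Rightarrow> real list \<Rightarrow> real \<Rightarrow> bool" for m where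
  refl: "u \<in> lists D \<Longrightarrow> m \<le> length u \<Longrightarrow> reach m u u 0"
| step: "reach m u v a \<Longrightarrow> edge v w c \<Longrightarrow> m \<le> length w \<Longrightarrow> reach m u w (a \<oplus> c)"

lemma edgeD:
  assumes "edge u v c"
  shows "u \<in> lists D" "v \<in> lists D" "c \<in> D"
    "\<And>i. i < length u \<Longrightarrow> i < length v \<Longrightarrow> tri (u ! i) (v ! i) c"
  using assms by (auto simp: edge_def edge0_def tri_def)

lemma edge_sym: "edge u v c \<Longrightarrow> edge v u c"
  by (auto simp: edge_def)

lemma reachD:
  assumes "reach m u v a"
  shows "u \<in> lists D" "v \<in> lists D" "a \<in> D" "m \<le> length u" "m \<le> length v"
  using assms by (induction; use zero_D dplus_D edgeD in blast)+

lemma reach_trans: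
  assumes "reach m u v a" "reach m v w b"
  shows "reach m u w (a \<oplus> b)"
  using assms(2,1)
proof induction
  case (refl v)
  then show ?case using reachD(3)[OF refl(3)] by (simp add: dplus_commute[of a])
next
  case (step v x b w c)
  then have "reach m u w ((a \<oplus> b) \<oplus> c)" by (blast intro: reach.step)
  then show ?case
    using dplus_assoc reachD(3)[OF step.prems] reachD(3)[OF step.hyps(1)] edgeD(3)[OF step.hyps(2)] by simp
qed

lemma reach_edge:
  assumes "edge u v c" "m \<le> length u" "m \<le> length v"
  shows "reach m u v c"
  using reach.step[OF reach.refl[OF edgeD(1)[OF assms(1)] assms(2)] assms(1,3)] edgeD(3)[OF assms(1)]
  by simp

lemma reach_sym: "reach m u v a \<Longrightarrow> reach m v u a"
proof (induction rule: reach.induct)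
  case (refl u) then show ?case by (rule reach.refl)
next
  case (step u v a w c)
  have "reach m w v c"
    using reach_edge[OF edge_sym[OF step.hyps(2)] step.hyps(3) reachD(5)[OF step.hyps(1)]] .
  from reach_trans[OF this step.IH] show ?case by (simp add: dplus_commute)
qed

lemma reach_mono: "reach m u v a \<Longrightarrow> m' \<le> m \<Longrightarrow> reach m' u v a"
  by (induction rule: reach.induct) (auto intro: reach.intros)

text \<open>All words of the path have a letter at position \<open>i\<close>, so the triangle
  inequalities of the edges add up; associativity merges each edge into the path length.\<close>

lemma reach_letter:
  assumes "reach m u v a" "i < m"
  shows "v ! i \<le> u ! i \<oplus> a"
  using assms
proof induction
  case (refl u)
  then have "u ! i \<in> D" by auto
  then show ?case by (simp add: dplus_commute[of _ 0])
next
  case (step u v a w c)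
  have D: "u ! i \<in> D" "w ! i \<in> D" "v ! i \<in> D" "a \<in> D" "c \<in> D"
    using reachD[OF step.hyps(1)] edgeD[OF step.hyps(2)] step.hyps(3) step.prems by auto
  have "i < length v" "i < length w" using reachD(5)[OF step.hyps(1)] step.hyps(3) step.prems by auto
  then have "w ! i \<le> v ! i + c" using edgeD(4)[OF step.hyps(2)] by (simp add: tri_def)
  also have "\<dots> \<le> (u ! i \<oplus> a) + c" using step.IH step.prems by simp
  finally have "w ! i \<le> (u ! i \<oplus> a) \<oplus> c" using D dplus_ge dplus_D by blast
  then show ?case using D dplus_assoc by simp
qed

text \<open>The path is cut at its first shortest word \<open>y\<close>. Unless \<open>y\<close> is
  the start \<open>u\<close>, it is entered from a longer word, so it is the shorter end of an edge
  and contains \<open>0\<close>.\<close>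

lemma reach_via_shortest:
  assumes "reach 0 u v a"
  shows "\<exists>y b c. reach (length y) u y b \<and> reach (length y) y v c \<and> a = b \<oplus> c \<and>
    (y = u \<or> (\<exists>i<length y. y ! i = 0))"
  using assms
proof induction
  case (refl u)
  then show ?case using reach.refl[of u "length u"] zero_D by (intro exI[of _ u] exI[of _ 0]) auto
next
  case (step u v a w c)
  then obtain y b b' where y: "reach (length y) u y b" "reach (length y) y v b'" "a = b \<oplus> b'"
    "y = u \<or> (\<exists>i<length y. y ! i = 0)" by blast
  have cD: "c \<in> D" and bD: "b \<in> D" "b' \<in> D" using edgeD(3)[OF step.hyps(2)] reachD(3) y by auto
  show ?case
  proof (cases "length y \<le> length w")
    case True
    then have "reach (length y) y w (b' \<oplus> c)" using reach.step[OF y(2) step.hyps(2)] by blast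
    moreover have "a \<oplus> c = b \<oplus> (b' \<oplus> c)" using y(3) dplus_assoc bD cD by simp
    ultimately show ?thesis using y(1,4) by blast
  next
    case False
    then have len: "length w < length y" "length y \<le> length v" using reachD(5)[OF y(2)] by auto
    have "reach (length y) u v a" using reach_trans y by blast
    then have "reach (length w) u v a" using len(1) by (auto intro: reach_mono)
    then have "reach (length w) u w (a \<oplus> c)" using step.hyps(2) by (blast intro: reach.step)
    moreover have "reach (length w) w w 0" using edgeD(2)[OF step.hyps(2)] by (auto intro: reach.refl)
    moreover have "a \<oplus> c = (a \<oplus> c) \<oplus> 0"
      using dplus_D[OF reachD(3)[OF step.hyps(1)] cD] by (simp add: dplus_commute[of _ 0])
    moreover have "\<exists>i<length w. w ! i = 0"
      using step.hyps(2) len by (auto simp: edge_def edge0_def)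
    ultimately show ?thesis by blast
  qed
qed

lemma edge_le_reach:
  assumes e: "edge0 u v c" and r: "reach 0 u v a"
  shows "c \<le> a"
proof -
  obtain y b b' where y: "reach (length y) u y b" "reach (length y) y v b'" "a = b \<oplus> b'"
    "y = u \<or> (\<exists>i<length y. y ! i = 0)" using reach_via_shortest[OF r] by blast
  then obtain i where i: "i < length y" "y ! i = 0" using e by (auto simp: edge0_def)
  have D: "b \<in> D" "b' \<in> D" using reachD(3) y by auto
  \<comment> \<open>As \<open>y ! i = 0\<close>, the two halves of the path bound the letters at
    \<open>i\<close>, whose sum in turn bounds \<open>c\<close>.\<close>
  have "u ! i \<le> b" "v ! i \<le> b'"
    using reach_letter[OF reach_sym[OF y(1)] i(1)] reach_letter[OF y(2) i(1)] i(2) D by simp_all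
  moreover have "tri (u ! i) (v ! i) c" using e i(1) reachD(4)[OF y(1)] by (auto simp: edge0_def)
  ultimately have "c \<le> b + b'" by (simp add: tri_def)
  then show ?thesis using dplus_ge D e y(3) by (simp add: edge0_def)
qed

text \<open>\<open>Max D\<close> is the default for words that no path joins. Being the largest
  distance, it changes no other minimum and breaks no triangle inequality.\<close>

definition wdist :: "real list \<Rightarrow> real list \<Rightarrow> real" where
  "wdist u v = (if u = v then 0 else Min (insert (Max D) {a. reach 0 u v a}))"

lemma finite_reach: "finite {a. reach 0 u v a}"
  using reachD(3) by (intro finite_subset[OF _ finite_D]) blast

lemma Max_D: "Max D \<in> D" "c \<in> D \<Longrightarrow> c \<le> Max D"
  using finite_D zero_D by (auto intro: Max_in)

lemma wdist_cases:
  assumes "u \<noteq> v"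
  obtains "wdist u v = Max D" | "reach 0 u v (wdist u v)"
  using Min_in[of "insert (Max D) {a. reach 0 u v a}"] finite_reach[of u v] assms
  by (auto simp: wdist_def)

lemma wdist_le_reach: "reach 0 u v a \<Longrightarrow> wdist u v \<le> a"
  using finite_reach[of u v] reachD(3) D_nonneg by (auto simp: wdist_def)

lemma wdist_le_Max: "wdist u v \<le> Max D"
  using finite_reach[of u v] Max_D D_nonneg by (auto simp: wdist_def)

lemma wdist_D: "wdist u v \<in> D"
proof (cases "u = v")
  case True then show ?thesis using zero_D by (simp add: wdist_def)
next
  case False
  then show ?thesis by (rule wdist_cases) (use Max_D reachD(3) in \<open>auto\<close>)
qed

lemma wdist_sym: "wdist u v = wdist v u"
proof -
  have "reach 0 u v = reach 0 v u" using reach_sym by blast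
  then show ?thesis by (simp add: wdist_def)
qed

lemma wdist_triangle: "wdist u w \<le> wdist u v + wdist v w"
proof -
  have nn: "0 \<le> wdist x y" for x y using D_nonneg wdist_D by blast
  show ?thesis
  proof (cases "u = v \<or> v = w")
    case True then show ?thesis by (auto simp: wdist_def)
  next
    case False
    show ?thesis
    proof (rule wdist_cases[of u v])
      show "u \<noteq> v" using False by blast
      assume "wdist u v = Max D"
      then show ?thesis using wdist_le_Max[of u w] nn[of v w] by simp
    next
      assume uv: "reach 0 u v (wdist u v)"
      show ?thesis
      proof (rule wdist_cases[of v w])
        show "v \<noteq> w" using False by blast
        assume "wdist v w = Max D"
        then show ?thesis using wdist_le_Max[of u w] nn[of u v] by simp
      next
        assume vw: "reach 0 v w (wdist v w)"
        then show ?thesis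
          using wdist_le_reach[OF reach_trans[OF uv vw]] dplus_le[OF wdist_D[of u v] wdist_D[of v w]] by simp
      qed
    qed
  qed
qed

lemma wdist_edge:
  assumes "edge0 u v c"
  shows "wdist u v = c"
proof (rule antisym)
  have "reach 0 u v c" using assms reach_edge[of u v c 0] by (simp add: edge_def)
  then show "wdist u v \<le> c" by (rule wdist_le_reach)
  have "u \<noteq> v" using assms by (auto simp: edge0_def)
  then show "c \<le> wdist u v"
  proof (rule wdist_cases)
    assume "wdist u v = Max D"
    then show ?thesis using assms Max_D(2) by (simp add: edge0_def)
  next
    assume "reach 0 u v (wdist u v)"
    then show ?thesis by (rule edge_le_reach[OF assms])
  qed
qed

lemma words_embed:
  obtains P where "\<And>u. u \<in> lists D \<Longrightarrow> P u \<in> M"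
    "\<And>u v c. edge0 u v c \<Longrightarrow> d (P u) (P v) = c"
proof -
  have cnt: "countable (lists D)" using finite_D by (simp add: countable_finite)
  define e where "e = from_nat_into (lists D)"
  define i where "i = to_nat_on (lists D)"
  have ei: "e (i u) = u" if "u \<in> lists D" for u using cnt that by (simp add: e_def i_def)
  obtain p where p: "\<And>n. p n \<in> M" "\<And>m n. d (p m) (p n) = wdist (e m) (e n)"
    by (rule countable_space_embeds[of "\<lambda>m n. wdist (e m) (e n)"])
      (auto simp: wdist_D wdist_sym wdist_triangle wdist_def[of u u for u])
  have "d (p (i u)) (p (i v)) = c" if "edge0 u v c" for u v c
    using p(2) ei that wdist_edge[OF that] by (simp add: edge0_def)
  then show ?thesis using that[of "p \<circ> i"] p(1) by simp
qed

section \<open>Coding points by words\<close>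

text \<open>A finite \<open>M\<close> has no room for \<open>card M + 1\<close> points at mutual
  distance \<open>r\<close>. Infinity of \<open>M\<close> permits an injective enumeration.\<close>

lemma M_infinite:
  assumes "r \<in> D" "0 < r"
  shows "infinite M"
proof
  assume fin: "finite M"
  define dF where "dF i j = (if i = j then 0 else r)" for i j :: nat
  have "metric_on {..card M} dF" "dist_set {..card M} dF \<subseteq> D"
    using assms zero_D by (auto simp: metric_on_def dist_set_def dF_def)
  then obtain f where f: "isometric_embedding {..card M} dF M d f"
    using space finite_atMost[of "card M"] unfolding urysohn_space_def by metis
  have "inj_on f {..card M}"
  proof (rule inj_onI)
    fix i j assume ij: "i \<in> {..card M}" "j \<in> {..card M}" "f i = f j"
    then have "f i \<in> M" "d (f i) (f j) = dF i j"
      using f unfolding isometric_embedding_def by blast+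
    then have "dF i j = 0" using ij(3) by simp
    then show "i = j" using assms(2) by (auto simp: dF_def split: if_splits)
  qed
  moreover have "f ` {..card M} \<subseteq> M" using f by (simp add: isometric_embedding_def)
  ultimately have "card {..card M} \<le> card M" using fin by (metis card_inj_on_le)
  then show False by simp
qed

text \<open>Each point \<open>e i\<close> owns a block of positions, one for each truncation level in \<open>ds @ [0]\<close>. The word of
  \<open>e n\<close> stops just before the level \<open>0\<close> of its own block, where the letter \<open>0\<close> would occur.\<close>

definition letter :: "(nat \<Rightarrow> 'a) \<Rightarrow> real list \<Rightarrow> nat \<Rightarrow> 'a \<Rightarrow> real" where
  "letter e ds j x = max (d x (e (j div Suc (length ds)))) ((ds @ [0]) ! (j mod Suc (length ds)))"

definition point_word :: "(nat \<Rightarrow> 'a) \<Rightarrow> real list \<Rightarrow> nat \<Rightarrow> real list" where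
  "point_word e ds n = map (\<lambda>j. letter e ds j (e n)) [0..<n * Suc (length ds) + length ds]"

lemma length_point_word [simp]: "length (point_word e ds n) = n * Suc (length ds) + length ds"
  by (simp add: point_word_def)

lemma nth_point_word: "j < n * Suc (length ds) + length ds \<Longrightarrow> point_word e ds n ! j = letter e ds j (e n)"
  by (simp add: point_word_def)

text \<open>The distances of \<open>x\<close> and \<open>y\<close> to a third point form such a
  triple with \<open>d x y\<close>. Truncating both from below does not increase their difference or
  decrease their sum.\<close>

lemma letter_tri:
  assumes e: "\<And>i. e i \<in> M" and xy: "x \<in> M" "y \<in> M"
    and ds: "set ds \<subseteq> D"
  shows "tri (letter e ds j x) (letter e ds j y) (d x y)"
proof -
  define z where "z = e (j div Suc (length ds))"
  define t where "t = (ds @ [0]) ! (j mod Suc (length ds))"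
  have "t \<in> D" using ds zero_D nth_mem[of "j mod Suc (length ds)" "ds @ [0]"] by (auto simp: t_def)
  then have "0 \<le> t" by (rule D_nonneg)
  moreover have "z \<in> M" using e by (simp add: z_def)
  ultimately show ?thesis
    using d_triangle[OF xy(1) \<open>z \<in> M\<close> xy(2)] d_triangle[OF xy \<open>z \<in> M\<close>] d_triangle[OF xy(2,1) \<open>z \<in> M\<close>]
      d_sym[OF xy] d_sym[OF xy(2) \<open>z \<in> M\<close>] d_nonneg[OF xy]
    unfolding letter_def z_def[symmetric] t_def[symmetric] tri_def by (auto simp: max_def)
qed

text \<open>The position is the level \<open>0\<close> slot in the block of \<open>e i\<close>,
  where truncation has no effect. Its letter will be compared with the \<open>0\<close> appended to
  the shorter word.\<close>

lemma nth_point_word_old: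
  assumes e: "\<And>i. e i \<in> M" and "i < n"
  shows "point_word e ds n ! length (point_word e ds i) = d (e n) (e i)"
proof -
  have "i * Suc (length ds) + length ds < n * Suc (length ds)"
    using mult_le_mono1[of "Suc i" n "Suc (length ds)"] assms(2) by simp
  then have "point_word e ds n ! length (point_word e ds i) =
      letter e ds (i * Suc (length ds) + length ds) (e n)"
    unfolding length_point_word by (intro nth_point_word) linarith
  moreover have "(i * Suc (length ds) + length ds) div Suc (length ds) = i"
    "(i * Suc (length ds) + length ds) mod Suc (length ds) = length ds"
    by (rule div_mod_block; simp)+
  ultimately show ?thesis
    using d_nonneg[OF e e, of n i] unfolding letter_def by simp
qed

lemma letter_D:
  assumes e: "\<And>i. e i \<in> M" and x: "x \<in> M" and ds: "set ds \<subseteq> D"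
  shows "letter e ds j x \<in> D"
proof -
  have "(ds @ [0]) ! (j mod Suc (length ds)) \<in> D"
    using ds zero_D nth_mem[of "j mod Suc (length ds)" "ds @ [0]"] by auto
  then show ?thesis using d_in_D[OF x e] by (simp add: letter_def max_def)
qed

text \<open>In the block of \<open>e n\<close> itself the distance is \<open>0\<close>, so every
  level shows up as a letter. In any block a letter below \<open>q\<close> forces the distance below
  \<open>q\<close>, so the slot of level \<open>q\<close> holds \<open>q\<close> itself.\<close>

lemma point_word_pwords:
  assumes e: "\<And>i. e i \<in> M" "inj e" and ds: "set (r # ps) = D - {0}" "sorted_wrt (>) (r # ps)"
  shows "point_word e (r # ps) n \<in> pwords {r} ps"
proof -
  define qs where "qs = r # ps"
  define k where "k = Suc (length qs)"
  define w where "w = point_word e qs n"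
  have qsD: "set qs = D - {0}" "sorted_wrt (>) qs" using ds by (auto simp: qs_def)
  have len: "length w = n * k + length qs" by (simp add: w_def k_def)
  have nth: "w ! j = max (d (e n) (e (j div k))) ((qs @ [0]) ! (j mod k))" if "j < n * k + length qs" for j
    using that by (simp add: w_def k_def nth_point_word letter_def)
  have k_le: "m < k" if "m < length qs" for m using that by (simp add: k_def)
  have letters: "w ! j \<in> D - {0}" if j: "j < n * k + length qs" for j
  proof -
    have "w ! j \<in> D"
      using letter_D[of e "e n" qs j] e(1) qsD(1) j by (auto simp: w_def nth_point_word k_def)
    moreover have "w ! j \<noteq> 0"
    proof (cases "j < n * k")
      case True
      then have "j div k < n" by (simp add: less_mult_imp_div_less)
      then have "e n \<noteq> e (j div k)" using e(2) by (auto dest: injD)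
      then have "0 < d (e n) (e (j div k))" using d_nonneg d_eq_0 e(1) by (simp add: less_le)
      then show ?thesis using nth[OF j] by (simp add: max_def)
    next
      case False
      then obtain m where m: "j = n * k + m" "m < length qs" using j le_Suc_ex[of "n * k" j] by auto
      then have "j mod k = m" using div_mod_block(2)[of m k n] k_le by simp
      then have "(qs @ [0]) ! (j mod k) \<in> D - {0}" using m(2) qsD(1) nth_mem[OF m(2)] by (auto simp: nth_append)
      then have "0 < (qs @ [0]) ! (j mod k)" using D_nonneg by (auto simp: less_le)
      then show ?thesis using nth[OF j] by (simp add: max_def)
    qed
    ultimately show ?thesis by blast
  qed
  have "w \<in> pwords {r} ps"
  proof (rule pwordsI)
    show "set w \<subseteq> {r} \<union> set ps"
      using letters ds(1) len by (auto simp: in_set_conv_nth)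
    show "sorted_wrt (>) ps" "set ps \<inter> {r} = {}" using ds(2) by auto
    show "set ps \<subseteq> set w"
    proof
      fix q assume "q \<in> set ps"
      then have qq: "q \<in> set qs" by (simp add: qs_def)
      then obtain m where m: "m < length qs" "qs ! m = q" by (auto simp: in_set_conv_nth)
      have "(n * k + m) div k = n" "(n * k + m) mod k = m" using m(1) div_mod_block[of m k n] k_le by simp_all
      moreover have "0 \<le> q" using qq qsD(1) D_nonneg by auto
      ultimately have "w ! (n * k + m) = q" using nth[of "n * k + m"] m e(1) by (simp add: nth_append)
      then show "q \<in> set w" using len m(1) by (metis nat_add_left_cancel_less nth_mem)
    qed
    fix i q assume i: "i < length w" "q \<in> set ps" "w ! i < q"
    then have qq: "q \<in> set qs" by (simp add: qs_def)
    then obtain m where m: "m < length qs" "qs ! m = q" by (auto simp: in_set_conv_nth)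
    have lt: "d (e n) (e (i div k)) < q" "(qs @ [0]) ! (i mod k) < q" using nth[of i] i len by simp_all
    \<comment> \<open>Levels descend within a block and the level at \<open>i\<close> is below
      \<open>qs ! m\<close>, so slot \<open>m\<close> comes earlier in the same block.\<close>
    have mi: "m < i mod k"
    proof (rule ccontr)
      assume "\<not> m < i mod k"
      then have im: "i mod k \<le> m" by simp
      then have "qs ! m \<le> qs ! (i mod k)"
        using sorted_wrt_nth_less[OF qsD(2), of "i mod k" m] m(1) by (cases "i mod k = m") auto
      then show False using lt(2) im m by (simp add: nth_append)
    qed
    define j where "j = i div k * k + m"
    have "j < i" using mi by (metis j_def div_mult_mod_eq nat_add_left_cancel_less)
    have "j div k = i div k" "j mod k = m" using m(1) div_mod_block[of m k "i div k"] k_le by (simp_all add: j_def)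
    then have "w ! j = q" using nth[of j] lt(1) m \<open>j < i\<close> i(1) len by (simp add: nth_append)
    then show "q \<in> set (take i w)" using \<open>j < i\<close> i(1) by (auto simp: in_set_conv_nth)
  qed
  then show ?thesis by (simp add: w_def qs_def)
qed

text \<open>Insertions are harmless: the constant \<open>r\<close> satisfies
  \<open>tri r r c\<close> for every distance \<open>c\<close>, and a copied letter repeats a triple
  known from \<open>letter_tri\<close>.\<close>

lemma edge0_point_words:
  assumes e: "\<And>i. e i \<in> M" "inj e" and ds: "set ds \<subseteq> D" "r \<in> D" "\<And>c. c \<in> D \<Longrightarrow> c \<le> r"
    and v: "valid {r} J l" and "i < n"
  shows "edge0 (app J l (point_word e ds i) @ [0]) (app J l (point_word e ds n) @ [0]) (d (e i) (e n))"
proof -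
  let ?w = "point_word e ds"
  let ?c = "d (e i) (e n)"
  have c: "?c \<in> D" "0 < ?c"
    using d_in_D d_nonneg d_eq_0 e \<open>i < n\<close> injD[OF e(2)] by (auto simp: less_le)
  have wl: "length (?w i) < length (?w n)" using mult_less_mono1[OF \<open>i < n\<close>, of "Suc (length ds)"] by (simp del: mult_Suc_right)
  then have len: "l (length (?w i)) < l (length (?w n))" using valid_less[OF v] by blast
  have "?w m \<in> lists D" for m
    using letter_D[OF e(1) e(1) ds(1)] by (auto simp: point_word_def)
  then have "app J l (?w m) @ [0] \<in> lists D" for m
    using app_lists[OF valid_mono[OF v, of D]] ds(2) zero_D by auto
  moreover have "tri ((app J l (?w i) @ [0]) ! j) ((app J l (?w n) @ [0]) ! j) ?c"
    if j: "j < length (app J l (?w i) @ [0])" for j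
  proof (cases "j = l (length (?w i))")
    case True
    \<comment> \<open>Here the shorter word has its appended \<open>0\<close>, and the longer one
      its letter of index \<open>length (?w i)\<close>, the untruncated distance.\<close>
    have "(app J l (?w n) @ [0]) ! j = d (e n) (e i)"
      using len valid_Ref[OF v] nth_point_word_old[OF e(1) \<open>i < n\<close>] True
      by (simp add: nth_append nth_app del: length_point_word)
    then show ?thesis using True c(2) d_sym[OF e(1) e(1), of n i]
      by (simp add: nth_append tri_def del: length_point_word)
  next
    case False
    then have j': "j < l (length (?w i))" using j by (simp del: length_point_word)
    have "tri (eval_sym (?w i) (J j)) (eval_sym (?w n) (J j)) ?c"
    proof (cases "J j")
      case (Con a)
      then have "a = r" using valid_sym[OF v j'] by auto
      then show ?thesis using Con ds(3)[OF c(1)] c(2) by (simp add: tri_def)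
    next
      case (Ref q)
      then have "q < length (?w i)" using valid_sym[OF v j'] by auto
      then have "?w i ! q = letter e ds q (e i)" "?w n ! q = letter e ds q (e n)"
        using wl nth_point_word[of q] by simp_all
      then show ?thesis using Ref letter_tri[OF e(1) e(1) e(1) ds(1)] by simp
    qed
    then show ?thesis using j' len by (simp add: nth_append nth_app del: length_point_word)
  qed
  moreover have "(app J l (?w i) @ [0]) ! l (length (?w i)) = 0"
    by (simp add: nth_append del: length_point_word)
  ultimately show ?thesis
    using c len unfolding edge0_def
    by (auto simp del: length_point_word intro!: exI[of _ "l (length (?w i))"])
qed

section \<open>The monochromatic copy\<close>

theorem indivisible:
  fixes col :: "'a \<Rightarrow> bool"
  shows "\<exists>c f. isometric_embedding M d M d f \<and> (\<forall>x\<in>M. col (f x) = c)"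
proof (cases "Max D = 0")
  case True
  then have "D = {0}" using Max_D D_nonneg zero_D by force
  then have "x = y" if "x \<in> M" "y \<in> M" for x y using d_in_D[OF that] d_eq_0[OF that] by simp
  moreover obtain x where "x \<in> M" using M_nonempty by blast
  ultimately have "isometric_embedding M d M d id \<and> (\<forall>y\<in>M. col (id y) = col x)"
    by (metis id_apply image_id isometric_embedding_def order_refl)
  then show ?thesis by blast
next
  case False
  define r where "r = Max D"
  have r: "r \<in> D" "0 < r" "\<And>c. c \<in> D \<Longrightarrow> c \<le> r"
    using False Max_D D_nonneg[OF Max_D(1)] by (auto simp: r_def)
  define ps where "ps = rev (sorted_list_of_set (D - {0, r}))"
  have ps: "set ps = D - {0, r}" "sorted_wrt (>) ps"
    using finite_D strict_sorted_list_of_set[of "D - {0, r}"]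
    by (simp_all add: ps_def sorted_wrt_rev)
  have ds: "set (r # ps) = D - {0}" "sorted_wrt (>) (r # ps)"
    using ps r by (auto simp: less_le)
  have "distinct ps" by (simp add: ps_def)
  have M: "countable M" "infinite M"
    using space M_infinite[OF r(1,2)] by (auto simp: urysohn_space_def)
  define e where "e = from_nat_into M"
  define ix where "ix = to_nat_on M"
  have bij: "bij_betw e UNIV M" using bij_betw_from_nat_into[OF M] by (simp add: e_def)
  have e: "\<And>i. e i \<in> M" "inj e" using bij by (auto simp: bij_betw_def)
  have ix: "e (ix x) = x" if "x \<in> M" for x using that M by (simp add: e_def ix_def)
  obtain P where P: "\<And>u. u \<in> lists D \<Longrightarrow> P u \<in> M" "\<And>u v c. edge0 u v c \<Longrightarrow> d (P u) (P v) = c"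
    using words_embed by blast
  \<comment> \<open>With \<open>{r}\<close> as alphabet of constants only the largest distance can
    be inserted. Words are coloured through their images in \<open>M\<close> after the final
    \<open>0\<close> is appended.\<close>
  have "canonizable {r} ps" using ps(1) \<open>distinct ps\<close> by (intro canonizable) auto
  then obtain J l c where v: "valid {r} J l" and c: "\<And>u. u \<in> pwords {r} ps \<Longrightarrow> col (P (app J l u @ [0])) = c"
    unfolding canonizable_def by (elim allE[of _ "\<lambda>w. col (P (w @ [0]))"] exE conjE) blast
  define N where "N n = app J l (point_word e (r # ps) n) @ [0]" for n
  have dsD: "set (r # ps) \<subseteq> D" using ds(1) by blast
  have edge: "edge0 (N i) (N n) (d (e i) (e n))" if "i < n" for i n
    unfolding N_def by (rule edge0_point_words[OF e dsD r(1,3) v that])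
  have N: "P (N n) \<in> M" for n using edge[of n "Suc n"] P(1) by (simp add: edge0_def)
  have dN: "d (P (N i)) (P (N n)) = d (e i) (e n)" for i n
  proof (cases i n rule: linorder_cases)
    case less then show ?thesis using P(2)[OF edge] by simp
  next
    case equal then show ?thesis using N e(1) by simp
  next
    case greater
    then show ?thesis using P(2)[OF edge] d_sym[OF N N] d_sym[OF e(1) e(1)] by metis
  qed
  have "isometric_embedding M d M d (\<lambda>x. P (N (ix x)))"
    using N dN ix by (auto simp: isometric_embedding_def)
  moreover have "col (P (N n)) = c" for n
    unfolding N_def by (rule c[OF point_word_pwords[OF e ds]])
  ultimately show ?thesis by blast
qed

end

theorem theorem9p1:
  fixes D :: "real set" and M :: "'a set" and d :: "'a \<Rightarrow> 'a \<Rightarrow> real"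
    and col :: "'a \<Rightarrow> nat"
  assumes "finite D" and "0 \<in> D" and "\<forall>r\<in>D. 0 \<le> r"
    and "universal_dist_set D"
    and "urysohn_space D M d"
    and "\<forall>x\<in>M. col x \<in> {0, 1}"
  shows "\<exists>i\<in>{0, 1::nat}. \<exists>f. isometric_embedding M d M d f \<and> (\<forall>x\<in>f ` M. col x = i)"
proof -
  interpret urysohn D M d by standard (use assms in auto)
  obtain c f where f: "isometric_embedding M d M d f" "\<And>x. x \<in> M \<Longrightarrow> (col (f x) = 1) = c"
    using indivisible[of "\<lambda>x. col x = 1"] by blast
  have "f x \<in> M" if "x \<in> M" for x using f(1) that by (auto simp: isometric_embedding_def)
  then have "\<forall>x\<in>f ` M. col x = (if c then 1 else 0)" using f(2) assms(6) by auto
  then show ?thesis using f(1) by (intro bexI[of _ "if c then 1 else 0"]) auto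
qed

end
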